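(* Let $p \geq 5$ be a prime number, let $n \geq 3$ be an integer, and let $f(X) = X^n + a_{n-1}X^{n-1} + \cdots + a_1 X + a_0 \in \mathbb{F}_p[X]$ be a primitive polynomial of degree $n$. Then $-a_0 \neq 1$ in $\mathbb{F}_p$. Moreover, if $n$ is not divisible by $p-1$, then $(-a_0)^n \neq 1$ in $\mathbb{F}_p$, and in this case $$\langle G_1, G_2, \ldots, G_n \rangle = \mathrm{GL}_n(\mathbb{F}_p),$$ where $C$ is the companion matrix of $f$, $G$ is the companion matrix of $X^n - 1 \in \mathbb{F}_p[X]$, $G_1 := C$, and $G_{k+1} := G\,G_k\,G^{-1}$ for all $1 \leq k \leq n-1$.
   Context: The companion matrix of a monic polynomial $X^n + b_{n-1}X^{n-1} + \cdots + b_1 X + b_0 \in \mathbb{F}_p[X]$ is the $n \times n$ matrix $M$ over $\mathbb{F}_p$ with $M E_k = E_{k+1}$ for $1 \leq k \leq n-1$ and $M E_n = \sum_{i=1}^n -b_{i-1} E_i$, where $E_1,\dots,E_n$ is the canonical basis of column vectors (ones on the subdiagonal, last column $(-b_0, -b_1, \ldots, -b_{n-1})^T$, zeros elsewhere). A monic polynomial $f \in \mathbb{F}_p[X]$ of degree $n$ is primitive if it is the minimal polynomial over $\mathbb{F}_p$ of a generator of the cyclic group $\mathbb{F}_{p^n}^\times$. $\langle \cdots \rangle$ denotes the subgroup of $\mathrm{GL}_n(\mathbb{F}_p)$ generated by the listed elements. *)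

theory Defs
  imports
    "Jordan_Normal_Form.Matrix"
    "Berlekamp_Zassenhaus.Finite_Field"
    "HOL-Algebra.Algebraic_Closure_Type"
    "HOL-Algebra.Generated_Groups"
    "HOL-Algebra.Multiplicative_Group"
begin

(* Indices are 0-based: ones on the subdiagonal, last column the negated
   non-leading coefficients. Meant for monic f. *)
definition companion_mat :: "'a :: comm_ring_1 poly \<Rightarrow> 'a mat" where
  "companion_mat f = mat (Polynomial.degree f) (Polynomial.degree f)
     (\<lambda>(i, j). if j = Polynomial.degree f - 1 then - Polynomial.coeff f i else if i = j + 1 then 1 else 0)"

definition GL :: "nat \<Rightarrow> 'a :: field mat monoid" where
  "GL n = units_of (ring_mat TYPE('a) n ())"

definition is_minimal_poly :: "'a :: field poly \<Rightarrow> 'a alg_closure \<Rightarrow> bool" where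
  "is_minimal_poly f x \<longleftrightarrow>
     monic f \<and> poly (map_poly to_ac f) x = 0 \<and>
     (\<forall>g. g \<noteq> 0 \<and> poly (map_poly to_ac g) x = 0 \<longrightarrow> Polynomial.degree f \<le> Polynomial.degree g)"

(* The field with p^n elements is realised as the subfield K of that cardinality
   in the algebraic closure of F_p. *)
definition primitive_poly :: "'p :: prime_card mod_ring poly \<Rightarrow> bool" where
  "primitive_poly f \<longleftrightarrow>
     (\<exists>K x. subfield K (ring_of_type_algebra :: 'p mod_ring alg_closure ring) \<and>
        card K = CARD('p) ^ Polynomial.degree f \<and> x \<in> K - {0} \<and>
        generate (mult_of (ring_of_type_algebra\<lparr>carrier := K\<rparr>)) {x} = K - {0} \<and>
        is_minimal_poly f x)"

lemma companion_mat_mult_unit_vec: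
  fixes f :: "'a :: comm_ring_1 poly"
  assumes "k + 1 < Polynomial.degree f"
  shows "companion_mat f *\<^sub>v unit_vec (Polynomial.degree f) k = unit_vec (Polynomial.degree f) (k + 1)"
  using assms by (intro eq_vecI) (auto simp: companion_mat_def)

lemma companion_mat_mult_last_unit_vec:
  fixes f :: "'a :: comm_ring_1 poly"
  assumes "0 < Polynomial.degree f"
  shows "companion_mat f *\<^sub>v unit_vec (Polynomial.degree f) (Polynomial.degree f - 1) = vec (Polynomial.degree f) (\<lambda>i. - Polynomial.coeff f i)"
  using assms by (intro eq_vecI) (auto simp: companion_mat_def)

end

theory Submission
  imports Defs "Jordan_Normal_Form.Determinant"
begin

text \<open>
  Write \<open>b = (-1)^n * a_0\<close>. This is the norm of a root \<open>x\<close> of \<open>f\<close>, namely the power of \<open>x\<close> with exponent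
  \<open>1 + p + ... + p^(n-1)\<close>. Since \<open>x\<close> has order \<open>p^n - 1\<close>, the element \<open>b\<close> has order exactly \<open>p - 1\<close>
  (\<open>norm_power_eq_1\<close>, \<open>norm_generates\<close>), and both inequalities for \<open>-a_0\<close> follow.

  For the generation statement let \<open>H\<close> be the generated group. The matrix \<open>C\<close> factors as \<open>G * S\<close> with \<open>S\<close> a
  homology: the identity except in its last column, with determinant \<open>-a_0\<close>. The product
  \<open>G_n * ... * G_1\<close> telescopes to \<open>G^n * S^n = S^n\<close>, so \<open>H\<close> contains \<open>S^n\<close>
  (\<open>homology_power_in\<close>), a homology of determinant \<open>(-a_0)^n\<close>, which is not 1. Identify the column space with
  \<open>K\<close>, the field with \<open>p^n\<close> elements, through the basis \<open>1, x, ..., x^(n-1)\<close>. Then \<open>C\<close> is multiplication by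
  \<open>x\<close>, so its powers are all nonzero scalings of \<open>K\<close>: a Singer cycle.

  It remains to see that a Singer cycle and one homology generate all transvections when \<open>n \<ge> 3\<close> and \<open>p\<close> is
  odd. Every functional on \<open>K\<close> is \<open>y \<mapsto> ell (c * y)\<close> for one fixed nonzero functional \<open>ell\<close>, so every
  rank-one perturbation of the identity is \<open>y \<mapsto> y + ell (c * y) * a\<close>. Conjugation by scalings shows that its
  membership in \<open>H\<close> depends only on \<open>a * c\<close>; let \<open>W\<close> be the set of products that occur and \<open>U\<close> the kernel of
  \<open>ell\<close>. For a suitable choice of \<open>ell\<close> the homology says that \<open>1\<close> is in \<open>W\<close> but not in \<open>U\<close>. All transvections lie in
  \<open>H\<close> as soon as \<open>U \<subseteq> W\<close>. Commutators give (\<open>realised_rank_one_commutator\<close>): if \<open>r\<close> and \<open>s\<close> are in \<open>W\<close>,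
  \<open>z\<close> is a nonzero element of \<open>U\<close>, and \<open>r * s / z\<close> is not in \<open>U\<close>, then \<open>z\<close> is in \<open>W\<close>. From this,
  \<open>U \<subseteq> W\<close> is pure field arithmetic (\<open>hyperplane_subset\<close>). If \<open>U\<close> were closed under inversion, Hua's
  identity would make it closed under multiplication by squares of its elements; this forces those squares into the prime
  field and the dimension of \<open>U\<close> down to one. So some transvection is available, and a count shows
  that an incomplete \<open>W\<close> would leave too many elements of \<open>U\<close> whose inverses satisfy two independent linear conditions.

  Finally, column reduction by transvections brings every invertible matrix to a dilation of the last basis vector with the
  same determinant (\<open>reduce_to_dilation\<close>). Powers of \<open>C\<close> have every nonzero determinant, because \<open>det C = b\<close>, so
  \<open>H\<close> contains all these dilations, and therefore all invertible matrices.
\<close>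
section \<open>Hyperplanes of a finite field\<close>

lemma card_proper_subgroup_le:
  fixes A B :: "'a :: ab_group_add set"
  assumes fin: "finite A" and sub: "B \<subset> A"
    and A_add: "\<And>y z. y \<in> A \<Longrightarrow> z \<in> A \<Longrightarrow> y + z \<in> A"
    and B_diff: "\<And>y z. y \<in> B \<Longrightarrow> z \<in> B \<Longrightarrow> y - z \<in> B"
  shows "2 * card B \<le> card A"
proof -
  from sub obtain g where g: "g \<in> A" "g \<notin> B" by blast
  have "B \<inter> (+) g ` B = {}"
  proof (rule ccontr)
    assume "B \<inter> (+) g ` B \<noteq> {}"
    then obtain b where "b \<in> B" "g + b \<in> B" by blast
    from B_diff[OF this(2,1)] g(2) show False by simp
  qed
  moreover have "card ((+) g ` B) = card B" by (simp add: card_image)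
  moreover have "finite B" using fin sub by (auto intro: finite_subset)
  ultimately have "card (B \<union> (+) g ` B) = 2 * card B" by (simp add: card_Un_disjoint)
  moreover have "B \<union> (+) g ` B \<subseteq> A" using sub g A_add by auto
  ultimately show ?thesis using card_mono[OF fin, of "B \<union> (+) g ` B"] by simp
qed

text \<open>
  The setting is a finite field \<open>K\<close> with a subfield \<open>F\<close> and an \<open>F\<close>-hyperplane \<open>U\<close> missing \<open>1\<close>, so that
  \<open>K = F + U\<close>. The inequality \<open>card_less\<close> says that \<open>U\<close> has dimension at least two.
\<close>

locale field_hyperplane =
  fixes K F U :: "'a :: field set"
  assumes finite_K: "finite K"
    and K_mult: "\<And>y z. y \<in> K \<Longrightarrow> z \<in> K \<Longrightarrow> y * z \<in> K"
    and K_inverse: "\<And>y. y \<in> K \<Longrightarrow> inverse y \<in> K"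
    and F_sub: "F \<subseteq> K"
    and F_diff: "\<And>y z. y \<in> F \<Longrightarrow> z \<in> F \<Longrightarrow> y - z \<in> F"
    and F_mult: "\<And>y z. y \<in> F \<Longrightarrow> z \<in> F \<Longrightarrow> y * z \<in> F"
    and F_two: "inverse 2 \<in> F"
    and U_sub: "U \<subseteq> K"
    and U_zero: "0 \<in> U"
    and U_diff: "\<And>y z. y \<in> U \<Longrightarrow> z \<in> U \<Longrightarrow> y - z \<in> U"
    and U_scale: "\<And>c y. c \<in> F \<Longrightarrow> y \<in> U \<Longrightarrow> c * y \<in> U"
    and codim: "\<And>y. y \<in> K \<Longrightarrow> \<exists>c \<in> F. y - c \<in> U"
    and one_notin: "1 \<notin> U"
    and two_nz: "(2 :: 'a) \<noteq> 0"
    and card_less: "card F < card U"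
begin

lemma finite_U: "finite U"
  using finite_K U_sub by (rule finite_subset[rotated])

lemma U_uminus: "y \<in> U \<Longrightarrow> - y \<in> U"
  using U_diff[OF U_zero] by fastforce

lemma U_add: "y \<in> U \<Longrightarrow> z \<in> U \<Longrightarrow> y + z \<in> U"
  using U_diff[of y "- z"] U_uminus by simp

text \<open>
  Multiplication by \<open>w\<close> is injective; if it mapped the finite set \<open>U\<close> to itself it would be onto, so
  \<open>w\<close> would be \<open>w * y\<close> with \<open>y\<close> in \<open>U\<close>, that is, \<open>1\<close> would lie in \<open>U\<close>.
\<close>

lemma not_stabilised:
  assumes w: "w \<in> U" "w \<noteq> 0"
  shows "\<exists>y \<in> U. w * y \<notin> U"
proof (rule ccontr)
  assume "\<not> ?thesis"
  then have "(*) w ` U \<subseteq> U" by blast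
  moreover have "inj_on ((*) w) U" using w by (simp add: inj_on_def)
  ultimately have "(*) w ` U = U" using finite_U by (simp add: endo_inj_surj)
  then obtain y where "y \<in> U" "w = w * y" using w(1) by blast
  then show False using w(2) one_notin by simp
qed

text \<open>
  This is Hua's identity \<open>y - inverse (inverse y + inverse (inverse z - y)) = y * z * y\<close>, whose left-hand side uses
  nothing but subtraction and inversion.
\<close>

lemma square_mult_closed:
  assumes inv: "\<And>z. z \<in> U \<Longrightarrow> inverse z \<in> U" and y: "y \<in> U" and z: "z \<in> U"
  shows "y * y * z \<in> U"
proof (cases "y = 0 \<or> z = 0 \<or> y * z = 1")
  case True
  then show ?thesis using U_zero y by (auto simp: mult.assoc)
next
  case False
  define w where "w = inverse y + inverse (inverse z - y)"
  have d: "inverse z - y \<noteq> 0" using False by (auto simp: field_simps)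
  have "w = 1 / (y * (1 - y * z))"
    using False d unfolding w_def by (auto simp: field_simps)
  then have "inverse w = y - y * y * z" by (simp add: algebra_simps)
  moreover have "inverse w \<in> U" unfolding w_def by (intro inv U_add U_diff y z)
  ultimately have "y - (y - y * y * z) \<in> U" using U_diff y by metis
  then show ?thesis by simp
qed

text \<open>
  The geometric content is that no polarity without absolute points commutes with a Singer cycle in dimension at least three: a map from points to
  hyperplanes that commutes with all scalings of \<open>K\<close> and has a symmetric incidence relation would come from an
  inversion-closed hyperplane \<open>U\<close>, and absolute points are excluded because \<open>1\<close> is not in \<open>U\<close>.
\<close>

lemma not_inverse_closed:
  "\<exists>z \<in> U. inverse z \<notin> U"
proof (rule ccontr)
  assume "\<not> ?thesis"
  then have inv: "\<And>z. z \<in> U \<Longrightarrow> inverse z \<in> U" by blast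
  have sq: "y * y \<in> F" if y: "y \<in> U" for y
  proof -
    obtain c where c: "c \<in> F" "y * y - c \<in> U" using codim K_mult y U_sub by blast
    \<comment> \<open>Both \<open>y * y\<close> and the scalar \<open>c\<close> stabilise \<open>U\<close>, so their difference, an element of \<open>U\<close>, does too.\<close>
    have "(y * y - c) * z \<in> U" if "z \<in> U" for z
      using U_diff[OF square_mult_closed[OF inv y that] U_scale[OF c(1) that]] by (simp add: algebra_simps)
    then have "y * y - c = 0" using not_stabilised[OF c(2)] by blast
    then show ?thesis using c(1) by simp
  qed
  have "F \<noteq> {}" using F_two by blast
  then have "card F \<ge> 1" using finite_K F_sub by (simp add: Suc_leI card_gt_0_iff finite_subset)
  then have "U \<noteq> {0}" using card_less by auto
  then obtain w where w: "w \<in> U" "w \<noteq> 0" using U_zero by blast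
  \<comment> \<open>Polarising the squares leaves \<open>U\<close> inside the line \<open>F / w\<close>.\<close>
  have "w * y \<in> F" if y: "y \<in> U" for y
  proof -
    have "((w + y) * (w + y) - w * w) - y * y \<in> F"
      by (intro F_diff sq U_add w y)
    then have "2 * (w * y) \<in> F" by (simp add: algebra_simps)
    from F_mult[OF F_two this] have "inverse 2 * (2 * (w * y)) \<in> F" .
    moreover have "inverse 2 * (2 * (w * y)) = w * y" using two_nz by (simp flip: mult.assoc)
    ultimately show ?thesis by simp
  qed
  then have "(*) w ` U \<subseteq> F" by blast
  moreover have "inj_on ((*) w) U" using w by (simp add: inj_on_def)
  ultimately have "card U \<le> card F"
    using finite_K F_sub by (metis card_image card_mono finite_subset)
  then show False using card_less by simp
qed

text \<open>
  The hypothesis on \<open>r\<close>, \<open>s\<close> and \<open>z\<close> is what commutators of rank-one maps provide. Some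
  \<open>z0\<close> in \<open>U\<close> has its inverse outside \<open>U\<close>, hence lies in \<open>W\<close>. Every element \<open>z\<close> of \<open>U\<close> outside \<open>W\<close> then has
  both \<open>inverse z\<close> and \<open>z0 * inverse z\<close> in \<open>U\<close>. Those inverses lie in a proper subgroup \<open>Y\<close> of \<open>U\<close>, while
  \<open>W \<inter> U\<close> is another one, and two proper subgroups have together at most as many elements as \<open>U\<close>. The
  contradiction comes from \<open>0\<close>, which lies in both of them.
\<close>

lemma hyperplane_subset:
  assumes one: "1 \<in> W"
    and W_diff: "\<And>y z. y \<in> W \<inter> U \<Longrightarrow> z \<in> W \<inter> U \<Longrightarrow> y - z \<in> W"
    and comm: "\<And>r s z. r \<in> W \<Longrightarrow> s \<in> W \<Longrightarrow> z \<in> U \<Longrightarrow> z \<noteq> 0 \<Longrightarrow> r * s / z \<in> K - U \<Longrightarrow> z \<in> W"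
  shows "U \<subseteq> W"
proof (rule ccontr)
  assume not_sub: "\<not> U \<subseteq> W"
  obtain z0 where z0: "z0 \<in> U" "inverse z0 \<notin> U" using not_inverse_closed by blast
  have "z0 \<noteq> 0" using z0 U_zero by auto
  then have w: "z0 \<in> W" "z0 \<in> U" "z0 \<noteq> 0"
    using comm[OF one one z0(1)] z0 K_inverse U_sub by (auto simp: field_simps)
  define Y where "Y = {y \<in> U. z0 * y \<in> U}"
  have "2 * card (W \<inter> U) \<le> card U"
    by (rule card_proper_subgroup_le[OF finite_U]) (use not_sub W_diff U_diff U_add in auto)
  moreover have "2 * card Y \<le> card U"
  proof (rule card_proper_subgroup_le[OF finite_U])
    show "Y \<subset> U" using not_stabilised[OF w(2,3)] unfolding Y_def by blast
    show "y - z \<in> Y" if "y \<in> Y" "z \<in> Y" for y z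
      using that U_diff unfolding Y_def by (auto simp: right_diff_distrib)
  qed (rule U_add)
  moreover have "card (U - W) < card Y"
  proof -
    have zW: "0 \<in> W" using W_diff[of z0 z0] w by simp
    have "inverse z \<in> Y - {0}" if z: "z \<in> U - W" for z
    proof -
      have "z \<noteq> 0" using z zW by auto
      moreover have zK: "inverse z \<in> K" "z0 * inverse z \<in> K"
        using z w(2) subsetD[OF U_sub] by (auto intro: K_inverse K_mult)
      moreover have "inverse z \<in> U" using comm[OF one one, of z] z zK \<open>z \<noteq> 0\<close> by (auto simp: field_simps)
      moreover have "z0 * inverse z \<in> U" using comm[OF w(1) one, of z] z zK \<open>z \<noteq> 0\<close> by (auto simp: field_simps)
      ultimately show ?thesis by (simp add: Y_def)
    qed
    then have "inverse ` (U - W) \<subseteq> Y - {0}" by (rule image_subsetI)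
    moreover have fY: "finite Y" using finite_U by (simp add: Y_def)
    moreover have "card (inverse ` (U - W)) = card (U - W)"
      by (simp add: card_image inj_on_def)
    ultimately have "card (U - W) \<le> card (Y - {0})"
      by (metis card_mono finite_Diff)
    also have "\<dots> < card Y" using fY U_zero by (intro card_Diff1_less) (auto simp: Y_def)
    finally show ?thesis .
  qed
  moreover have "card U = card (W \<inter> U) + card (U - W)"
    using finite_U by (metis Int_commute card_Diff_subset_Int card_mono finite_Int inf.cobounded1 le_add_diff_inverse)
  ultimately show False by linarith
qed

end

section \<open>Rank-one updates of the identity and elimination by transvections\<close>

text \<open>
  The matrix of \<open>v \<mapsto> v + (m \<bullet> v) w\<close>: a transvection when \<open>m \<bullet> w = 0\<close> (and neither vector is zero), and a homology when
  \<open>m \<bullet> w\<close> is neither \<open>0\<close> nor \<open>-1\<close>.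
\<close>

definition rank_one_update :: "nat \<Rightarrow> 'a :: comm_ring_1 vec \<Rightarrow> 'a vec \<Rightarrow> 'a mat" where
  "rank_one_update n w m = mat n n (\<lambda>(i, j). (if i = j then 1 else 0) + w $ i * m $ j)"

lemma rank_one_update_carrier [simp]: "rank_one_update n w m \<in> carrier_mat n n"
  by (simp add: rank_one_update_def)

lemma rank_one_update_dim [simp]:
  "dim_row (rank_one_update n w m) = n" "dim_col (rank_one_update n w m) = n"
  by (simp_all add: rank_one_update_def)

lemma rank_one_update_mult_vec:
  assumes "w \<in> carrier_vec n" "m \<in> carrier_vec n" "v \<in> carrier_vec n"
  shows "rank_one_update n w m *\<^sub>v v = v + (m \<bullet> v) \<cdot>\<^sub>v w"
proof (rule eq_vecI)
  fix i assume "i < dim_vec (v + (m \<bullet> v) \<cdot>\<^sub>v w)"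
  then have i: "i < n" using assms by auto
  have "(rank_one_update n w m *\<^sub>v v) $ i = (\<Sum>j = 0..<n. (if i = j then v $ j else 0) + w $ i * (m $ j * v $ j))"
    using i assms by (auto simp: rank_one_update_def scalar_prod_def algebra_simps intro!: sum.cong)
  also have "\<dots> = v $ i + w $ i * (m \<bullet> v)"
    using i assms by (simp add: sum.distrib scalar_prod_def sum_distrib_left)
  finally show "(rank_one_update n w m *\<^sub>v v) $ i = (v + (m \<bullet> v) \<cdot>\<^sub>v w) $ i"
    using i assms by (simp add: mult.commute)
qed (use assms in auto)

lemma add_zero_smult_vec :
  fixes v w :: "'a :: semiring_1 vec"
  assumes "v \<in> carrier_vec n" "w \<in> carrier_vec n"
  shows "v + 0 \<cdot>\<^sub>v w = v"
  using assms by (intro eq_vecI) auto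

lemma mult_unit_vec_index:
  fixes A :: "'a :: comm_ring_1 mat"
  assumes "A \<in> carrier_mat n n" "i < n" "j < n"
  shows "(A *\<^sub>v unit_vec n j) $ i = A $$ (i, j)"
proof -
  have "(A *\<^sub>v unit_vec n j) $ i = row A i \<bullet> unit_vec n j" using assms(1,2) by simp
  also have "\<dots> = row A i $ j" using assms(3) by (rule scalar_prod_right_unit)
  also have "\<dots> = A $$ (i, j)" using assms by simp
  finally show ?thesis .
qed

lemma mat_eq_on_vecsI:
  fixes A B :: "'a :: comm_ring_1 mat"
  assumes A: "A \<in> carrier_mat n n" and B: "B \<in> carrier_mat n n"
    and eq: "\<And>v. v \<in> carrier_vec n \<Longrightarrow> A *\<^sub>v v = B *\<^sub>v v"
  shows "A = B"
proof (rule eq_matI)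
  fix i j assume "i < dim_row B" "j < dim_col B"
  then have ij: "i < n" "j < n" using B by auto
  show "A $$ (i, j) = B $$ (i, j)"
    using eq[OF unit_vec_carrier[of n j]]
    unfolding mult_unit_vec_index[OF A ij, symmetric] mult_unit_vec_index[OF B ij, symmetric] by simp
qed (use A B in auto)

lemma rank_one_update_mult:
  fixes m w w' :: "'a :: comm_ring_1 vec"
  assumes w: "w \<in> carrier_vec n" and w': "w' \<in> carrier_vec n" and m: "m \<in> carrier_vec n"
  shows "rank_one_update n w m * rank_one_update n w' m = rank_one_update n (w' + (1 + m \<bullet> w') \<cdot>\<^sub>v w) m"
proof (rule mat_eq_on_vecsI[where n = n])
  fix v :: "'a vec" assume v: "v \<in> carrier_vec n"
  have "m \<bullet> (v + (m \<bullet> v) \<cdot>\<^sub>v w') = m \<bullet> v + (m \<bullet> v) * (m \<bullet> w')"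
    using v m w' by (simp add: scalar_prod_add_distrib[of m n])
  moreover have "rank_one_update n w m * rank_one_update n w' m *\<^sub>v v
      = rank_one_update n w m *\<^sub>v (rank_one_update n w' m *\<^sub>v v)"
    using v by (intro assoc_mult_mat_vec) auto
  ultimately have "rank_one_update n w m * rank_one_update n w' m *\<^sub>v v
      = (v + (m \<bullet> v) \<cdot>\<^sub>v w') + (m \<bullet> v + (m \<bullet> v) * (m \<bullet> w')) \<cdot>\<^sub>v w"
    using v w' by (simp add: rank_one_update_mult_vec[OF w' m v] rank_one_update_mult_vec[OF w m])
  also have "\<dots> = v + (m \<bullet> v) \<cdot>\<^sub>v (w' + (1 + m \<bullet> w') \<cdot>\<^sub>v w)"
    using v w w' by (intro eq_vecI) (auto simp: algebra_simps)
  also have "\<dots> = rank_one_update n (w' + (1 + m \<bullet> w') \<cdot>\<^sub>v w) m *\<^sub>v v"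
    using v w w' m by (simp add: rank_one_update_mult_vec)
  finally show "rank_one_update n w m * rank_one_update n w' m *\<^sub>v v
      = rank_one_update n (w' + (1 + m \<bullet> w') \<cdot>\<^sub>v w) m *\<^sub>v v" .
qed (auto intro: mult_carrier_mat)

lemma rank_one_update_zero: "rank_one_update n (0\<^sub>v n) m = 1\<^sub>m n"
  by (rule eq_matI) (auto simp: rank_one_update_def)

text \<open>
  The \<open>k\<close>-th power of a transvection is the transvection with \<open>w\<close> replaced by \<open>k w\<close>, so its \<open>p\<close>-th power is the
  identity. Hence the determinant is a \<open>p\<close>-th root of unity in the prime field, where raising to the power \<open>p\<close> is trivial.
\<close>

lemma det_transvection:
  fixes w m :: "'p :: prime_card mod_ring vec"
  assumes w: "w \<in> carrier_vec n" and m: "m \<in> carrier_vec n" and mw: "m \<bullet> w = 0"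
  shows "det (rank_one_update n w m) = 1"
proof -
  let ?R = "\<lambda>k :: nat. rank_one_update n (of_nat k \<cdot>\<^sub>v w) m"
  have zero: "(0 :: 'p mod_ring) \<cdot>\<^sub>v w = 0\<^sub>v n" using w by (intro eq_vecI) auto
  have "det (?R k) = det (rank_one_update n w m) ^ k" for k
  proof (induction k)
    case 0
    show ?case by (simp add: zero rank_one_update_zero)
  next
    case (Suc k)
    have "m \<bullet> (of_nat k \<cdot>\<^sub>v w) = 0" using w m mw by simp
    moreover have "of_nat k \<cdot>\<^sub>v w + w = of_nat (Suc k) \<cdot>\<^sub>v w"
      using w by (intro eq_vecI) (auto simp: algebra_simps)
    ultimately have "rank_one_update n w m * ?R k = ?R (Suc k)"
      using rank_one_update_mult[OF w _ m, of "of_nat k \<cdot>\<^sub>v w"] w by simp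
    then show ?case using Suc det_mult[of "rank_one_update n w m" n "?R k"] by simp
  qed
  from this[of "CARD('p)"] have "det (rank_one_update n w m) ^ CARD('p) = 1"
    by (simp add: zero rank_one_update_zero)
  then show ?thesis using finite_field_power_card_eq_same[of "det (rank_one_update n w m)"] by simp
qed

lemma det_last_dilation:
  fixes d :: "'a :: comm_ring_1"
  assumes "n > 0"
  shows "det (rank_one_update n ((d - 1) \<cdot>\<^sub>v unit_vec n (n - 1)) (unit_vec n (n - 1))) = d"
proof -
  obtain l where n: "n = Suc l" using assms by (cases n) auto
  let ?D = "rank_one_update n ((d - 1) \<cdot>\<^sub>v unit_vec n (n - 1)) (unit_vec n (n - 1))"
  have "det ?D = prod_list (diag_mat ?D)"
    by (rule det_lower_triangular[of n]) (auto simp: rank_one_update_def n)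
  also have "\<dots> = (\<Prod>i = 0..<n. ?D $$ (i, i))" by (simp add: prod_list_diag_prod)
  also have "\<dots> = (\<Prod>i = 0..<l. 1) * d" unfolding n prod.atLeast0_lessThan_Suc
    by (intro arg_cong2[where f = "(*)"] prod.cong) (auto simp: rank_one_update_def)
  finally show ?thesis by simp
qed

text \<open>
  Column reduction multiplies on the left by transvections only, so closure under products suffices. Asking for
  determinant one lets the final dilation be read off from the determinant of the matrix that is reduced.
\<close>

locale transvection_monoid =
  fixes n :: nat and P :: "'a :: field mat set"
  assumes n_ge: "n \<ge> 2"
    and P_carrier: "A \<in> P \<Longrightarrow> A \<in> carrier_mat n n"
    and P_mult: "A \<in> P \<Longrightarrow> B \<in> P \<Longrightarrow> A * B \<in> P"
    and P_det: "A \<in> P \<Longrightarrow> det A = 1"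
    and P_transvection: "w \<in> carrier_vec n \<Longrightarrow> m \<in> carrier_vec n \<Longrightarrow> m \<bullet> w = 0 \<Longrightarrow> rank_one_update n w m \<in> P"
begin

text \<open>
  A nonzero entry of \<open>v\<close> strictly below position \<open>k\<close> leaves room for a single transvection: its direction must be the
  difference of target and source, and its functional, a combination of the coordinates \<open>k\<close> and \<open>j\<close>, is chosen to take
  the value one on both.
\<close>

lemma move_to_unit_vec:
  fixes v :: "'a vec"
  assumes v: "v \<in> carrier_vec n" and k: "k < j" "j < n" "v $ j \<noteq> 0"
  shows "\<exists>h \<in> P. (\<forall>i < k. h *\<^sub>v unit_vec n i = unit_vec n i) \<and> h *\<^sub>v v = unit_vec n k"
proof -
  define b where "b = (1 - v $ k) / v $ j"
  define m where "m = unit_vec n k + b \<cdot>\<^sub>v unit_vec n j"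
  define w where "w = unit_vec n k - v"
  have [simp]: "m \<in> carrier_vec n" "w \<in> carrier_vec n" using v by (auto simp: m_def w_def)
  have m: "m \<bullet> y = y $ k + b * y $ j" if "y \<in> carrier_vec n" for y
    using that k unfolding m_def by (subst add_scalar_prod_distrib[of _ n]) auto
  have mv: "m \<bullet> v = 1" using v k by (subst m) (auto simp: b_def)
  have mw: "m \<bullet> w = 0"
    using v k by (subst m) (auto simp: w_def b_def field_simps)
  have "rank_one_update n w m *\<^sub>v unit_vec n i = unit_vec n i" if "i < k" for i
  proof -
    have "m \<bullet> unit_vec n i = 0" using that k by (subst m) auto
    then show ?thesis by (subst rank_one_update_mult_vec) (auto simp: add_zero_smult_vec[of _ n])
  qed
  moreover have "rank_one_update n w m *\<^sub>v v = unit_vec n k"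
    using v k by (subst rank_one_update_mult_vec) (auto simp: mv w_def)
  ultimately show ?thesis using P_transvection[OF _ _ mw] by auto
qed

text \<open>
  If the pivot sits in position \<open>k\<close> itself, adding a multiple of the last unit vector first creates a nonzero entry
  below it. This needs \<open>k < n - 1\<close>, and it is why the last column can only be reduced to a dilation.
\<close>

lemma move_to_unit_vec':
  fixes v :: "'a vec"
  assumes v: "v \<in> carrier_vec n" and k: "k < n - 1" and j: "k \<le> j" "j < n" "v $ j \<noteq> 0"
  shows "\<exists>h \<in> P. (\<forall>i < k. h *\<^sub>v unit_vec n i = unit_vec n i) \<and> h *\<^sub>v v = unit_vec n k"
proof (cases "k = j")
  case False
  then show ?thesis using move_to_unit_vec[OF v _ j(2,3)] j(1) by simp
next
  case True
  show ?thesis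
  proof (cases "v $ (n - 1) = 0")
    case False
    then show ?thesis using move_to_unit_vec[OF v, of k "n - 1"] k by simp
  next
    case True
    define g where "g = rank_one_update n (unit_vec n (n - 1)) (unit_vec n k :: 'a vec)"
    have g: "g *\<^sub>v y = y + y $ k \<cdot>\<^sub>v unit_vec n (n - 1)" if "y \<in> carrier_vec n" for y
      using that k unfolding g_def by (subst rank_one_update_mult_vec) auto
    have gP: "g \<in> P" unfolding g_def using k by (intro P_transvection) auto
    have "(g *\<^sub>v v) $ (n - 1) \<noteq> 0" using g[OF v] v True k \<open>k = j\<close> j by auto
    moreover have "g *\<^sub>v v \<in> carrier_vec n" using v by (simp add: g)
    ultimately obtain h where h: "h \<in> P" "\<forall>i < k. h *\<^sub>v unit_vec n i = unit_vec n i" "h *\<^sub>v (g *\<^sub>v v) = unit_vec n k"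
      using move_to_unit_vec[of "g *\<^sub>v v" k "n - 1"] k by auto
    have "(h * g) *\<^sub>v unit_vec n i = unit_vec n i" if "i < k" for i
    proof -
      have "g *\<^sub>v unit_vec n i = unit_vec n i" using that k by (simp add: g add_zero_smult_vec[of _ n])
      then show ?thesis using h that P_carrier[OF h(1)] P_carrier[OF gP] by simp
    qed
    moreover have "(h * g) *\<^sub>v v = unit_vec n k"
      using h(3) P_carrier[OF h(1)] P_carrier[OF gP] v by simp
    ultimately show ?thesis using P_mult[OF h(1) gP] by blast
  qed
qed

text \<open>
  Otherwise column \<open>k\<close> would be a combination of the earlier unit vectors, all fixed by \<open>B\<close>. It would then be
  its own image, and \<open>B\<close> would identify it with the \<open>k\<close>-th unit vector.
\<close>

lemma column_has_pivot:
  fixes B :: "'a mat"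
  assumes B: "B \<in> carrier_mat n n" and det: "det B \<noteq> 0" and k: "k < n"
    and fix_B: "\<And>i. i < k \<Longrightarrow> B *\<^sub>v unit_vec n i = unit_vec n i"
  shows "\<exists>j \<ge> k. j < n \<and> (B *\<^sub>v unit_vec n k) $ j \<noteq> 0"
proof (rule ccontr)
  define v where "v = B *\<^sub>v unit_vec n k"
  have v: "v \<in> carrier_vec n" using B by (simp add: v_def)
  assume "\<not> ?thesis"
  then have zero: "v $ j = 0" if "k \<le> j" "j < n" for j using that by (auto simp: v_def)
  have "B *\<^sub>v v = v"
  proof (rule eq_vecI)
    fix i assume "i < dim_vec v"
    then have i: "i < n" using v by simp
    have entry: "B $$ (i, j) * v $ j = (if i = j then v $ j else 0)" if "j < n" for j
    proof (cases "j < k")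
      case True
      then show ?thesis using fix_B[OF True] mult_unit_vec_index[OF B i that] i that by auto
    qed (use zero that in auto)
    have "(B *\<^sub>v v) $ i = (\<Sum>j = 0..<n. B $$ (i, j) * v $ j)"
      using i B v by (auto simp: scalar_prod_def intro!: sum.cong)
    also have "\<dots> = (\<Sum>j = 0..<n. if i = j then v $ j else 0)"
      by (intro sum.cong) (auto simp: entry)
    also have "\<dots> = v $ i" using i by simp
    finally show "(B *\<^sub>v v) $ i = v $ i" .
  qed (use B v in auto)
  then have "B *\<^sub>v (v - unit_vec n k) = 0\<^sub>v n"
    using B v by (simp add: mult_minus_distrib_mat_vec flip: v_def)
  moreover have "v - unit_vec n k \<noteq> 0\<^sub>v n"
  proof
    assume "v - unit_vec n k = 0\<^sub>v n"
    then have "(v - unit_vec n k) $ k = 0" using k by simp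
    then show False using zero[of k] v k by simp
  qed
  moreover have "v - unit_vec n k \<in> carrier_vec n" using v by simp
  ultimately show False using det det_0_iff_vec_prod_zero_field[OF B] by blast
qed

lemma fix_initial_columns:
  assumes A: "A \<in> carrier_mat n n" and det: "det A \<noteq> 0"
  shows "k \<le> n - 1 \<Longrightarrow> \<exists>h \<in> P. \<forall>i < k. (h * A) *\<^sub>v unit_vec n i = unit_vec n i"
proof (induction k)
  case 0
  have "rank_one_update n (0\<^sub>v n) (0\<^sub>v n) \<in> P" by (intro P_transvection) auto
  then show ?case by auto
next
  case (Suc k)
  then obtain h where h: "h \<in> P" "\<And>i. i < k \<Longrightarrow> (h * A) *\<^sub>v unit_vec n i = unit_vec n i" by auto
  note hc = P_carrier[OF h(1)]
  have hA: "h * A \<in> carrier_mat n n" using hc A by simp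
  have "det (h * A) \<noteq> 0" using det P_det[OF h(1)] det_mult[OF hc A] by simp
  moreover have "k < n" using Suc.prems n_ge by simp
  ultimately obtain j where j: "k \<le> j" "j < n" "((h * A) *\<^sub>v unit_vec n k) $ j \<noteq> 0"
    using column_has_pivot[OF hA _ _ h(2)] by blast
  have "(h * A) *\<^sub>v unit_vec n k \<in> carrier_vec n" using hA by (metis mult_mat_vec_carrier unit_vec_carrier)
  from move_to_unit_vec'[OF this _ j] Suc.prems
  obtain g where g: "g \<in> P" "\<And>i. i < k \<Longrightarrow> g *\<^sub>v unit_vec n i = unit_vec n i"
    "g *\<^sub>v ((h * A) *\<^sub>v unit_vec n k) = unit_vec n k" by auto
  note gc = P_carrier[OF g(1)]
  have "(g * h * A) *\<^sub>v unit_vec n i = g *\<^sub>v ((h * A) *\<^sub>v unit_vec n i)" for i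
    using assoc_mult_mat[OF gc hc A] assoc_mult_mat_vec[OF gc hA unit_vec_carrier] by simp
  then have "\<forall>i < Suc k. (g * h * A) *\<^sub>v unit_vec n i = unit_vec n i"
    using g h(2) by (auto simp: less_Suc_eq)
  then show ?case using P_mult[OF g(1) h(1)] by blast
qed

lemma reduce_to_dilation:
  assumes A: "A \<in> carrier_mat n n" and det: "det A \<noteq> 0"
  shows "\<exists>h \<in> P. h * A = rank_one_update n ((det A - 1) \<cdot>\<^sub>v unit_vec n (n - 1)) (unit_vec n (n - 1))"
proof -
  define e :: "'a vec" where "e = unit_vec n (n - 1)"
  have [simp]: "e \<in> carrier_vec n" by (simp add: e_def)
  obtain h where h: "h \<in> P" "\<And>i. i < n - 1 \<Longrightarrow> (h * A) *\<^sub>v unit_vec n i = unit_vec n i"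
    using fix_initial_columns[OF A det, of "n - 1"] by auto
  note hc = P_carrier[OF h(1)]
  have hA: "h * A \<in> carrier_mat n n" using hc A by simp
  define v where "v = (h * A) *\<^sub>v e"
  have v: "v \<in> carrier_vec n" using hA by (simp add: v_def e_def)
  have "det (h * A) \<noteq> 0" using det P_det[OF h(1)] det_mult[OF hc A] by simp
  from column_has_pivot[OF hA this _ h(2), of "n - 1"] n_ge
  obtain j where "n - 1 \<le> j" "j < n" "v $ j \<noteq> 0" by (auto simp: v_def e_def)
  moreover from this have "j = n - 1" by simp
  ultimately have vn: "v $ (n - 1) \<noteq> 0" by simp
  define w where "w = (1 / v $ (n - 1)) \<cdot>\<^sub>v (v $ (n - 1) \<cdot>\<^sub>v e - v)"
  have [simp]: "w \<in> carrier_vec n" using v by (simp add: w_def)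
  define g where "g = rank_one_update n w e"
  have "e \<bullet> w = 0" using n_ge v by (simp add: e_def w_def)
  then have g: "g \<in> P" unfolding g_def by (intro P_transvection) auto
  note gc = P_carrier[OF g]
  have g_vec: "g *\<^sub>v y = y + y $ (n - 1) \<cdot>\<^sub>v w" if "y \<in> carrier_vec n" for y
    using that n_ge unfolding g_def by (subst rank_one_update_mult_vec) (auto simp: e_def)
  define d where "d = v $ (n - 1)"
  define D where "D = rank_one_update n ((d - 1) \<cdot>\<^sub>v e) e"
  have D_vec: "D *\<^sub>v y = y + y $ (n - 1) \<cdot>\<^sub>v ((d - 1) \<cdot>\<^sub>v e)" if "y \<in> carrier_vec n" for y
    using that n_ge unfolding D_def by (subst rank_one_update_mult_vec) (auto simp: e_def)
  have split: "(g * h * A) *\<^sub>v y = g *\<^sub>v ((h * A) *\<^sub>v y)" if "y \<in> carrier_vec n" for y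
    using gc hc A that assoc_mult_mat[OF gc hc A] assoc_mult_mat_vec[OF gc hA that] by simp
  have cols: "(g * h * A) *\<^sub>v unit_vec n i = D *\<^sub>v unit_vec n i" if i: "i < n" for i
  proof (cases "i < n - 1")
    case True
    then show ?thesis using h(2)[OF True] by (simp add: split g_vec D_vec add_zero_smult_vec[of _ n])
  next
    case False
    then have ei: "unit_vec n i = e" using i by (simp add: e_def)
    have "g *\<^sub>v v = D *\<^sub>v e"
    proof (rule eq_vecI)
      fix i assume "i < dim_vec (D *\<^sub>v e)"
      then have "i < n" by (simp add: D_def)
      then show "(g *\<^sub>v v) $ i = (D *\<^sub>v e) $ i"
        using v vn n_ge by (simp add: g_vec D_vec w_def d_def e_def field_simps)
    qed (simp add: g_def D_def)
    then show ?thesis by (simp add: ei split v_def)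
  qed
  have ghA: "g * h * A = D"
  proof (rule eq_matI)
    fix i j assume "i < dim_row D" "j < dim_col D"
    then have ij: "i < n" "j < n" by (auto simp: D_def)
    have "g * h * A \<in> carrier_mat n n" "D \<in> carrier_mat n n" using gc hc A by (auto simp: D_def)
    then show "(g * h * A) $$ (i, j) = D $$ (i, j)"
      using cols[OF ij(2)] mult_unit_vec_index[OF _ ij] by metis
  qed (use gc hc A in \<open>auto simp: D_def\<close>)
  have "det A = det (g * h * A)"
    using P_det[OF P_mult[OF g h(1)]] det_mult[OF _ A, of "g * h"] gc hc by simp
  also have "\<dots> = d" unfolding ghA D_def e_def by (rule det_last_dilation) (use n_ge in simp)
  finally show ?thesis using P_mult[OF g h(1)] ghA unfolding D_def e_def by auto
qed

end

section \<open>Companion matrices and the cyclic shift\<close>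

lemma det_companion_mat:
  fixes f :: "'a :: comm_ring_1 poly"
  assumes "Polynomial.degree f > 0"
  shows "det (companion_mat f) = (- 1) ^ Polynomial.degree f * Polynomial.coeff f 0"
proof -
  obtain l where n: "Polynomial.degree f = Suc l" using assms by (cases "Polynomial.degree f") auto
  let ?C = "companion_mat f"
  have C: "?C \<in> carrier_mat (Suc l) (Suc l)" by (simp add: companion_mat_def n)
  have minor: "mat_delete ?C 0 l = 1\<^sub>m l"
    by (rule eq_matI) (auto simp: mat_delete_def companion_mat_def n)
  have "det ?C = (\<Sum>j<Suc l. ?C $$ (0, j) * cofactor ?C 0 j)"
    by (rule laplace_expansion_row[OF C]) simp
  also have "\<dots> = ?C $$ (0, l) * cofactor ?C 0 l"
    by (simp add: companion_mat_def n)
  also have "\<dots> = - Polynomial.coeff f 0 * (- 1) ^ l"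
    by (simp add: cofactor_def minor) (simp add: companion_mat_def n)
  finally show ?thesis by (simp add: n mult.commute)
qed

lemma degree_monom_minus_one:
  assumes "n > 0"
  shows "Polynomial.degree (Polynomial.monom 1 n - 1 :: 'a :: comm_ring_1 poly) = n"
proof -
  have "Polynomial.degree (Polynomial.monom 1 n + (- 1) :: 'a poly) = Polynomial.degree (Polynomial.monom 1 n :: 'a poly)"
    using assms by (intro degree_add_eq_left) (simp add: degree_monom_eq)
  then show ?thesis by (simp add: degree_monom_eq)
qed

lemma predecessor_mod:
  fixes i n :: nat
  assumes "i < n"
  shows "(i + (n - 1)) mod n = (if i = 0 then n - 1 else i - 1)"
proof (cases "i = 0")
  case False
  then have "i + (n - 1) = (i - 1) + n" using assms by simp
  then have "(i + (n - 1)) mod n = (i - 1) mod n" by (simp only: mod_add_self2)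
  then show ?thesis using False assms by simp
qed (use assms in simp)

text \<open>
  The companion matrix of \<open>X^n - 1\<close> permutes the coordinates cyclically; adding \<open>n - 1\<close> modulo \<open>n\<close> is stepping back by one.
\<close>

lemma cyclic_shift_mult_vec:
  fixes v :: "'a :: comm_ring_1 vec"
  assumes n: "n \<ge> 2" and v: "v \<in> carrier_vec n"
  shows "companion_mat (Polynomial.monom 1 n - 1) *\<^sub>v v = vec n (\<lambda>i. v $ ((i + (n - 1)) mod n))"
proof -
  let ?f = "Polynomial.monom 1 n - 1 :: 'a poly"
  have deg: "Polynomial.degree ?f = n" using n by (intro degree_monom_minus_one) simp
  show ?thesis
  proof (rule eq_vecI)
    fix i assume "i < dim_vec (vec n (\<lambda>i. v $ ((i + (n - 1)) mod n)))"
    then have i: "i < n" by simp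
    define k where "k = (i + (n - 1)) mod n"
    have k: "k = (if i = 0 then n - 1 else i - 1)" unfolding k_def by (rule predecessor_mod[OF i])
    have kn: "k < n" using n by (simp add: k_def)
    have entry: "companion_mat ?f $$ (i, j) = (if j = k then 1 else 0)" if "j < n" for j
      using that i n unfolding k companion_mat_def deg by (auto simp: coeff_1)
    have "(companion_mat ?f *\<^sub>v v) $ i = (\<Sum>j = 0..<n. companion_mat ?f $$ (i, j) * v $ j)"
      using i v deg by (auto simp: scalar_prod_def companion_mat_def intro!: sum.cong)
    also have "\<dots> = (\<Sum>j = 0..<n. if j = k then v $ j else 0)"
      by (intro sum.cong) (auto simp: entry)
    also have "\<dots> = v $ k" using kn by simp
    finally show "(companion_mat ?f *\<^sub>v v) $ i = vec n (\<lambda>i. v $ ((i + (n - 1)) mod n)) $ i"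
      using i by (simp add: k_def)
  qed (simp add: companion_mat_def deg)
qed

lemma cyclic_shift_carrier:
  "n \<ge> 2 \<Longrightarrow> companion_mat (Polynomial.monom 1 n - 1 :: 'a :: comm_ring_1 poly) \<in> carrier_mat n n"
  by (simp add: companion_mat_def degree_monom_minus_one)

lemma cyclic_shift_power:
  fixes G :: "'a :: comm_ring_1 mat"
  assumes n: "n \<ge> 2" and G: "G = companion_mat (Polynomial.monom 1 n - 1)"
  shows "G ^\<^sub>m n = 1\<^sub>m n"
proof -
  have Gc: "G \<in> carrier_mat n n" unfolding G using n by (rule cyclic_shift_carrier)
  define d where "d = n - 1"
  have "G ^\<^sub>m k *\<^sub>v v = vec n (\<lambda>i. v $ ((i + k * d) mod n))" if v: "v \<in> carrier_vec n" for k v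
    using v
  proof (induction k arbitrary: v)
    case 0
    then show ?case using Gc by (intro eq_vecI) auto
  next
    case (Suc k)
    have "G ^\<^sub>m Suc k *\<^sub>v v = G ^\<^sub>m k *\<^sub>v (G *\<^sub>v v)"
      using Gc Suc.prems by (simp add: assoc_mult_mat_vec[of _ n n _ n])
    also have "\<dots> = vec n (\<lambda>i. (G *\<^sub>v v) $ ((i + k * d) mod n))"
      using Gc Suc.prems by (intro Suc.IH) auto
    also have "\<dots> = vec n (\<lambda>i. v $ ((i + Suc k * d) mod n))"
      unfolding G cyclic_shift_mult_vec[OF n Suc.prems, folded d_def]
      using n by (intro eq_vecI) (auto simp: mod_add_right_eq add_ac)
    finally show ?case .
  qed
  then show ?thesis using Gc by (intro mat_eq_on_vecsI[where n = n] pow_carrier_mat) auto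
qed

text \<open>
  The last column of \<open>inverse G * C\<close> minus the last unit vector: undoing the cyclic shift moves the coefficient \<open>a_0\<close>
  from the top of the last column of \<open>C\<close> to its bottom.
\<close>

definition last_column_change :: "nat \<Rightarrow> 'a :: comm_ring_1 poly \<Rightarrow> 'a vec" where
  "last_column_change n f =
     vec n (\<lambda>i. if i = n - 1 then - Polynomial.coeff f 0 - 1 else - Polynomial.coeff f (i + 1))"

lemma companion_factorisation:
  fixes f :: "'a :: comm_ring_1 poly"
  assumes n: "n \<ge> 2" and deg: "Polynomial.degree f = n"
  shows "companion_mat f = companion_mat (Polynomial.monom 1 n - 1)
    * rank_one_update n (last_column_change n f) (unit_vec n (n - 1))"
    (is "_ = ?G * ?S")
proof -
  have s: "last_column_change n f \<in> carrier_vec n" by (simp add: last_column_change_def)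
  have G: "?G \<in> carrier_mat n n" using n by (rule cyclic_shift_carrier)
  have C: "companion_mat f \<in> carrier_mat n n" by (simp add: companion_mat_def deg)
  show ?thesis
  proof (rule eq_matI)
    fix i j assume "i < dim_row (?G * ?S)" "j < dim_col (?G * ?S)"
    then have ij: "i < n" "j < n" using G by auto
    define k where "k = (i + (n - 1)) mod n"
    have k: "k = (if i = 0 then n - 1 else i - 1)" unfolding k_def by (rule predecessor_mod[OF ij(1)])
    have kn: "k < n" using n by (simp add: k_def)
    have "(?G * ?S) $$ (i, j) = (?G * ?S *\<^sub>v unit_vec n j) $ i"
      using ij G by (intro mult_unit_vec_index[symmetric]) auto
    also have "?G * ?S *\<^sub>v unit_vec n j = ?G *\<^sub>v (?S *\<^sub>v unit_vec n j)"
      using G by (intro assoc_mult_mat_vec) auto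
    also have "\<dots> $ i = (?S *\<^sub>v unit_vec n j) $ k"
      using ij n by (subst cyclic_shift_mult_vec) (auto simp: k_def intro!: mult_mat_vec_carrier[OF rank_one_update_carrier])
    also have "\<dots> = ?S $$ (k, j)" using kn ij by (intro mult_unit_vec_index) auto
    also have "\<dots> = companion_mat f $$ (i, j)"
      using ij kn n unfolding k
      by (auto simp: rank_one_update_def last_column_change_def companion_mat_def deg)
    finally show "companion_mat f $$ (i, j) = (?G * ?S) $$ (i, j)" ..
  qed (use C G in auto)
qed

text \<open>
  With \<open>C = G * S\<close> and \<open>A k = G^(k-1) * C * G^(1-k)\<close>, the product \<open>A k * ... * A 1\<close> telescopes to \<open>G^k * S^k\<close>. At
  \<open>k = n\<close> the shift disappears. The geometric sum of powers of \<open>-a_0\<close> is the factor by which \<open>S^k\<close> stretches the column change of \<open>S\<close>. Stating the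
  recursion for \<open>A\<close> without inverses keeps the lemma in the matrix algebra.
\<close>

lemma homology_power_in:
  fixes f :: "'a :: comm_ring_1 poly" and A :: "nat \<Rightarrow> 'a mat"
  assumes n: "n \<ge> 2" and deg: "Polynomial.degree f = n"
    and G: "G = companion_mat (Polynomial.monom 1 n - 1)"
    and A_in: "\<And>k. 1 \<le> k \<Longrightarrow> k \<le> n \<Longrightarrow> A k \<in> H"
    and A_1: "A 1 = companion_mat f"
    and A_Suc: "\<And>k. 1 \<le> k \<Longrightarrow> k \<le> n - 1 \<Longrightarrow> A (k + 1) * G = G * A k"
    and H_carrier: "\<And>B. B \<in> H \<Longrightarrow> B \<in> carrier_mat n n"
    and H_mult: "\<And>B B'. B \<in> H \<Longrightarrow> B' \<in> H \<Longrightarrow> B * B' \<in> H"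
    and H_one: "1\<^sub>m n \<in> H"
  shows "rank_one_update n ((\<Sum>i<n. (- Polynomial.coeff f 0) ^ i) \<cdot>\<^sub>v last_column_change n f) (unit_vec n (n - 1)) \<in> H"
proof -
  let ?s = "last_column_change n f" and ?e = "unit_vec n (n - 1) :: 'a vec"
  let ?a = "- Polynomial.coeff f 0"
  let ?R = "\<lambda>k. rank_one_update n ((\<Sum>i<k. ?a ^ i) \<cdot>\<^sub>v ?s) ?e"
  let ?S = "rank_one_update n ?s ?e"
  have s: "?s \<in> carrier_vec n" by (simp add: last_column_change_def)
  have es: "?e \<bullet> ?s = ?a - 1" using n by (simp add: last_column_change_def)
  have Gc: "G \<in> carrier_mat n n" unfolding G using n by (rule cyclic_shift_carrier)
  have Gk: "G ^\<^sub>m k \<in> carrier_mat n n" for k using Gc by simp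
  have Cc: "companion_mat f \<in> carrier_mat n n" by (simp add: companion_mat_def deg)
  have C: "companion_mat f = G * ?S" unfolding G by (rule companion_factorisation[OF n deg])
  have S_R: "?S * ?R k = ?R (Suc k)" for k
  proof -
    define t where "t = (\<Sum>i<k. ?a ^ i)"
    have "1 + (?a - 1) * t = ?a ^ k"
      unfolding t_def by (simp only: power_diff_1_eq[symmetric]) simp
    then have "1 + ?e \<bullet> (t \<cdot>\<^sub>v ?s) = ?a ^ k" using s n es by (simp add: mult.commute)
    then have "?S * rank_one_update n (t \<cdot>\<^sub>v ?s) ?e = rank_one_update n (t \<cdot>\<^sub>v ?s + ?a ^ k \<cdot>\<^sub>v ?s) ?e"
      using rank_one_update_mult[OF s _ unit_vec_carrier, of "t \<cdot>\<^sub>v ?s" "n - 1"] s by simp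
    also have "t \<cdot>\<^sub>v ?s + ?a ^ k \<cdot>\<^sub>v ?s = (t + ?a ^ k) \<cdot>\<^sub>v ?s"
      using s by (intro eq_vecI) (auto simp: algebra_simps)
    finally show ?thesis by (simp add: t_def)
  qed
  have conj: "A (k + 1) * G ^\<^sub>m k = G ^\<^sub>m k * companion_mat f" if "k < n" for k
    using that
  proof (induction k)
    case 0
    then show ?case using A_1 Cc Gc by simp
  next
    case (Suc k)
    have A1: "A (k + 1) \<in> carrier_mat n n" and A2: "A (Suc k + 1) \<in> carrier_mat n n"
      using Suc.prems by (auto intro!: H_carrier A_in)
    have comm: "G ^\<^sub>m Suc k = G * G ^\<^sub>m k" for k
    proof (induction k)
      case (Suc k)
      have "G ^\<^sub>m Suc (Suc k) = (G * G ^\<^sub>m k) * G" using Suc by simp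
      also have "\<dots> = G * (G ^\<^sub>m k * G)" by (rule assoc_mult_mat[OF Gc Gk Gc])
      finally show ?case by simp
    qed (use Gc in simp)
    have "A (Suc k + 1) * G ^\<^sub>m Suc k = (A (Suc k + 1) * G) * G ^\<^sub>m k"
      unfolding comm using A2 Gc Gk by (intro assoc_mult_mat[symmetric])
    also have "A (Suc k + 1) * G = G * A (k + 1)" using A_Suc[of "k + 1"] Suc.prems by simp
    also have "\<dots> * G ^\<^sub>m k = G * (A (k + 1) * G ^\<^sub>m k)" using A1 Gc Gk by (intro assoc_mult_mat)
    also have "A (k + 1) * G ^\<^sub>m k = G ^\<^sub>m k * companion_mat f" using Suc by simp
    also have "G * \<dots> = G ^\<^sub>m Suc k * companion_mat f"
      unfolding comm using Gc Gk Cc by (intro assoc_mult_mat[symmetric])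
    finally show ?case .
  qed
  have "G ^\<^sub>m k * ?R k \<in> H" if "k \<le> n" for k
    using that
  proof (induction k)
    case 0
    have "(0 :: 'a) \<cdot>\<^sub>v ?s = 0\<^sub>v n" using s by (intro eq_vecI) auto
    then show ?case using H_one Gc by (simp add: rank_one_update_zero)
  next
    case (Suc k)
    have A1: "A (k + 1) \<in> carrier_mat n n"
      using Suc.prems by (auto intro!: H_carrier A_in)
    have "G ^\<^sub>m Suc k * ?R (Suc k) = (G ^\<^sub>m k * G) * (?S * ?R k)" unfolding S_R by simp
    also have "\<dots> = G ^\<^sub>m k * (G * (?S * ?R k))"
      using Gc Gk by (intro assoc_mult_mat) (auto intro: mult_carrier_mat)
    also have "G * (?S * ?R k) = companion_mat f * ?R k"
      unfolding C using Gc by (intro assoc_mult_mat[symmetric]) auto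
    also have "G ^\<^sub>m k * (companion_mat f * ?R k) = (G ^\<^sub>m k * companion_mat f) * ?R k"
      using Gk Cc by (intro assoc_mult_mat[symmetric]) auto
    also have "\<dots> = (A (k + 1) * G ^\<^sub>m k) * ?R k" using conj[of k] Suc.prems by simp
    also have "\<dots> = A (k + 1) * (G ^\<^sub>m k * ?R k)"
      using A1 Gk by (intro assoc_mult_mat) auto
    finally show ?case using H_mult[OF A_in[of "k + 1"]] Suc by simp
  qed
  from this[of n] show ?thesis
    unfolding cyclic_shift_power[OF n G] by (simp add: left_mult_one_mat[OF rank_one_update_carrier])
qed

section \<open>The companion matrix of a primitive polynomial as field multiplication\<close>

lemma card_carrier_vec: "card (carrier_vec n :: 'a :: finite vec set) = CARD('a) ^ n"
proof -
  have "bij_betw list_of_vec (carrier_vec n :: 'a vec set) {xs. set xs \<subseteq> UNIV \<and> length xs = n}"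
  proof (rule bij_betw_byWitness[where f' = vec_of_list])
    show "vec_of_list ` {xs. set xs \<subseteq> UNIV \<and> length xs = n} \<subseteq> (carrier_vec n :: 'a vec set)"
      by (auto intro: carrier_vecI)
  qed (auto simp: vec_list list_vec)
  then have "card (carrier_vec n :: 'a vec set) = card {xs :: 'a list. set xs \<subseteq> UNIV \<and> length xs = n}"
    by (rule bij_betw_same_card)
  then show ?thesis by (simp only: card_lists_length_eq finite)
qed

text \<open>
  The locale keeps from primitivity only what the argument uses: \<open>K\<close> is the field with \<open>p^n\<close> elements and the root
  \<open>x\<close> generates its multiplicative group.
\<close>

locale primitive_field =
  fixes f :: "'p :: prime_card mod_ring poly" and K :: "'p mod_ring alg_closure set"
    and x :: "'p mod_ring alg_closure" and n :: nat
  assumes degree_f: "Polynomial.degree f = n" and n_pos: "n > 0"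
    and min_poly: "is_minimal_poly f x"
    and card_K: "card K = CARD('p) ^ n"
    and x_in: "x \<in> K" and x_nz: "x \<noteq> 0"
    and zero_in: "0 \<in> K" and one_in: "1 \<in> K"
    and diff_in: "y \<in> K \<Longrightarrow> z \<in> K \<Longrightarrow> y - z \<in> K"
    and mult_in: "y \<in> K \<Longrightarrow> z \<in> K \<Longrightarrow> y * z \<in> K"
    and power_of_x: "y \<in> K \<Longrightarrow> y \<noteq> 0 \<Longrightarrow> \<exists>i. y = x ^ i"
    and x_power_eq_1: "x ^ k = 1 \<longleftrightarrow> CARD('p) ^ n - 1 dvd k"

lemma primitive_poly_imp_primitive_field:
  assumes prim: "primitive_poly (f :: 'p :: prime_card mod_ring poly)" and n: "Polynomial.degree f = n" "n > 0"
  shows "\<exists>K x. primitive_field f K x n"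
proof -
  let ?R = "ring_of_type_algebra :: 'p mod_ring alg_closure ring"
  have mult_of_eq: "Ring_Divisibility.mult_of R = Multiplicative_Group.mult_of R" for R :: "'p mod_ring alg_closure ring"
    by (simp add: Ring_Divisibility.mult_of_def Multiplicative_Group.mult_of_def)
  from prim[unfolded primitive_poly_def n(1)] obtain K x where sf: "subfield K ?R"
    and card: "card K = CARD('p) ^ n" and x': "x \<in> K - {0}"
    and gen': "generate (mult_of (?R\<lparr>carrier := K\<rparr>)) {x} = K - {0}"
    and mp: "is_minimal_poly f x"
    by (elim exE conjE) (rule that)
  note gen = gen'[unfolded mult_of_eq]
  from x' have x: "x \<in> K" "x \<noteq> 0" by auto
  let ?M = "Multiplicative_Group.mult_of (?R\<lparr>carrier := K\<rparr>)"
  have R_simps: "monoid.mult ?R = (*)" "one ?R = 1" "ring.zero ?R = 0" "add ?R = (+)" "carrier ?R = UNIV"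
    by (simp_all add: ring_of_type_algebra_def fun_eq_iff)
  interpret R: field ?R by (rule field_from_type_algebra)
  note sub = subringE[OF subfieldE(1)[OF sf], unfolded R_simps]
  have uminus: "\<ominus>\<^bsub>?R\<^esub> y = - y" for y
    using R.l_neg[of y] unfolding R_simps eq_neg_iff_add_eq_0 by blast
  have fin: "finite K" using card by (intro card_ge_0_finite) simp
  interpret G: group ?M
    using field.field_mult_group[OF R.subfield_iff(2)[OF sf]] by (simp add: Multiplicative_Group.mult_of_def)
  have M_carrier: "carrier ?M = K - {0}" by (simp add: Multiplicative_Group.mult_of_def R_simps)
  have finM: "finite (carrier ?M)" using fin unfolding M_carrier by simp
  have xM: "x \<in> carrier ?M" using x unfolding M_carrier by simp
  have pow: "x [^]\<^bsub>?M\<^esub> (k :: nat) = x ^ k" for k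
    by (induction k) (simp_all add: Multiplicative_Group.mult_of_def R_simps nat_pow_def mult.commute)
  have "card (K - {0}) = CARD('p) ^ n - 1" using card sub(2) fin by simp
  then have ord: "G.ord x = CARD('p) ^ n - 1" using G.generate_pow_card[OF xM] gen by simp
  have "primitive_field f K x n"
  proof
    show "\<exists>i. y = x ^ i" if "y \<in> K" "y \<noteq> 0" for y
    proof -
      have "y \<in> generate ?M {x}" using that gen by simp
      then show ?thesis unfolding G.generate_pow_on_finite_carrier[OF finM xM] pow by blast
    qed
    show "x ^ k = 1 \<longleftrightarrow> CARD('p) ^ n - 1 dvd k" for k
      using G.pow_eq_id[OF xM, of k] unfolding pow ord by (simp add: Multiplicative_Group.mult_of_def R_simps)
    show "y - z \<in> K" if "y \<in> K" "z \<in> K" for y z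
      using sub(7)[OF that(1) sub(5)[OF that(2)]] by (simp add: uminus)
  qed (use n mp card x sub in auto)
  then show ?thesis by blast
qed

context primitive_field
begin

lemma finite_K: "finite K"
  using card_K by (intro card_ge_0_finite) simp

lemma uminus_in: "y \<in> K \<Longrightarrow> - y \<in> K"
  using diff_in[OF zero_in] by fastforce

lemma add_in: "y \<in> K \<Longrightarrow> z \<in> K \<Longrightarrow> y + z \<in> K"
  using diff_in[of y "- z"] uminus_in by simp

lemma power_in: "y \<in> K \<Longrightarrow> y ^ i \<in> K"
  by (induction i) (auto intro: mult_in one_in)

lemma sum_in: "(\<And>i. i \<in> A \<Longrightarrow> g i \<in> K) \<Longrightarrow> sum g A \<in> K"
  by (induction A rule: infinite_finite_induct) (auto intro: add_in zero_in)

lemma card_power_gt: "CARD('p) ^ n > 1"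
  using n_pos nontriv[where 'a = 'p] by (intro one_less_power) auto

lemma inverse_in: "y \<in> K \<Longrightarrow> inverse y \<in> K"
proof (cases "y = 0")
  case False
  assume "y \<in> K"
  then obtain i where y: "y = x ^ i" using False power_of_x by blast
  let ?N = "CARD('p) ^ n - 1"
  have "x ^ ?N = 1" using x_power_eq_1 by simp
  moreover have "Suc (?N - 1) = ?N" using card_power_gt by simp
  ultimately have "x * x ^ (?N - 1) = 1" by (metis power_Suc)
  then have "inverse x = x ^ (?N - 1)" by (rule inverse_unique)
  then have "inverse y = (x ^ (?N - 1)) ^ i" by (simp add: y flip: power_inverse)
  then show ?thesis using power_in x_in by simp
qed (use zero_in in simp)

lemma to_ac_in: "to_ac c \<in> K"
proof -
  have "of_nat i \<in> K" for i by (induction i) (auto intro: add_in zero_in one_in)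
  moreover obtain i where "c = of_nat i" using surj_of_nat_mod_ring by blast
  ultimately show ?thesis by simp
qed

lemma monic_f: "Polynomial.coeff f n = 1"
  using min_poly degree_f by (simp add: is_minimal_poly_def)

lemma root_f: "poly (map_poly to_ac f) x = 0"
  using min_poly by (simp add: is_minimal_poly_def)

lemma no_small_root:
  assumes "poly (map_poly to_ac g) x = 0" "Polynomial.degree g < n"
  shows "g = 0"
  using min_poly assms degree_f by (auto simp: is_minimal_poly_def not_less[symmetric])

lemma degree_map_f: "Polynomial.degree (map_poly to_ac f) = n"
  using degree_f by (subst degree_map_poly) auto

text \<open>
  The coordinate isomorphism for the basis \<open>1, x, ..., x^(n-1)\<close>, in which multiplication by \<open>x\<close> has the companion
  matrix of \<open>f\<close>. It is injective because \<open>x\<close> is no root of a nonzero polynomial of degree below \<open>n\<close>, and surjective by counting.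
\<close>

definition vec_to_K :: "'p mod_ring vec \<Rightarrow> 'p mod_ring alg_closure" where
  "vec_to_K v = (\<Sum>i<n. to_ac (v $ i) * x ^ i)"

lemma vec_to_K_in: "vec_to_K v \<in> K"
  unfolding vec_to_K_def by (intro sum_in mult_in to_ac_in power_in x_in)

lemma vec_to_K_add:
  "v \<in> carrier_vec n \<Longrightarrow> w \<in> carrier_vec n \<Longrightarrow> vec_to_K (v + w) = vec_to_K v + vec_to_K w"
  by (simp add: vec_to_K_def distrib_right sum.distrib)

lemma vec_to_K_smult: "v \<in> carrier_vec n \<Longrightarrow> vec_to_K (c \<cdot>\<^sub>v v) = to_ac c * vec_to_K v"
  by (simp add: vec_to_K_def sum_distrib_left mult.assoc)

lemma vec_to_K_unit: "i < n \<Longrightarrow> vec_to_K (unit_vec n i) = x ^ i"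
proof -
  assume i: "i < n"
  have "vec_to_K (unit_vec n i) = (\<Sum>j<n. if j = i then x ^ j else 0)"
    unfolding vec_to_K_def using i by (intro sum.cong) auto
  then show ?thesis using i by simp
qed

lemma vec_to_K_eq_0:
  assumes v: "v \<in> carrier_vec n" and eq: "vec_to_K v = 0"
  shows "v = 0\<^sub>v n"
proof -
  define g where "g = (\<Sum>i<n. Polynomial.monom (v $ i) i)"
  have coeff: "Polynomial.coeff g i = (if i < n then v $ i else 0)" for i
    by (simp add: g_def coeff_sum)
  then have deg: "Polynomial.degree g < n"
    using n_pos by (metis degree_0 le_degree leading_coeff_0_iff not_le)
  have "poly (map_poly to_ac g) x = (\<Sum>i\<le>Polynomial.degree g. to_ac (Polynomial.coeff g i) * x ^ i)"
    by (simp add: poly_altdef degree_map_poly coeff_map_poly)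
  also have "\<dots> = (\<Sum>i<n. to_ac (Polynomial.coeff g i) * x ^ i)"
    using deg by (intro sum.mono_neutral_left) (auto simp: coeff_eq_0)
  also have "\<dots> = vec_to_K v" unfolding vec_to_K_def by (intro sum.cong) (auto simp: coeff)
  finally have "g = 0" using eq deg no_small_root by simp
  then have "v $ i = 0" if "i < n" for i using coeff[of i] that by simp
  then show ?thesis using v by (intro eq_vecI) auto
qed

lemma vec_to_K_bij: "bij_betw vec_to_K (carrier_vec n) K"
proof -
  have inj: "inj_on vec_to_K (carrier_vec n)"
  proof (rule inj_onI)
    fix v w :: "'p mod_ring vec"
    assume vw: "v \<in> carrier_vec n" "w \<in> carrier_vec n" and eq: "vec_to_K v = vec_to_K w"
    have "vec_to_K (v + (- 1) \<cdot>\<^sub>v w) = 0"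
      using vw eq by (simp add: vec_to_K_add vec_to_K_smult)
    then have "v + (- 1) \<cdot>\<^sub>v w = 0\<^sub>v n" using vw by (intro vec_to_K_eq_0) auto
    then have "(v + (- 1) \<cdot>\<^sub>v w) $ i = 0" if "i < n" for i using that by simp
    then show "v = w" using vw by (intro eq_vecI) auto
  qed
  moreover have "vec_to_K ` carrier_vec n = K"
    using finite_K inj by (intro card_subset_eq) (auto simp: vec_to_K_in card_image card_carrier_vec card_K)
  ultimately show ?thesis by (simp add: bij_betw_def)
qed

lemma vec_to_K_eqD:
  "v \<in> carrier_vec n \<Longrightarrow> w \<in> carrier_vec n \<Longrightarrow> vec_to_K v = vec_to_K w \<Longrightarrow> v = w"
  using vec_to_K_bij by (auto simp: bij_betw_def inj_on_def)

lemma K_cases: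
  assumes "y \<in> K"
  obtains v where "v \<in> carrier_vec n" "y = vec_to_K v"
  using assms vec_to_K_bij by (auto simp: bij_betw_def)

lemma vec_to_K_mult_mat_vec:
  fixes A :: "'p mod_ring mat"
  assumes A: "A \<in> carrier_mat n n" and v: "v \<in> carrier_vec n"
  shows "vec_to_K (A *\<^sub>v v) = (\<Sum>j<n. to_ac (v $ j) * vec_to_K (A *\<^sub>v unit_vec n j))"
proof -
  have "vec_to_K (A *\<^sub>v v) = (\<Sum>i<n. (\<Sum>j<n. to_ac (A $$ (i, j)) * to_ac (v $ j)) * x ^ i)"
    unfolding vec_to_K_def using A v
    by (intro sum.cong) (auto simp: scalar_prod_def to_ac_sum atLeast0LessThan intro!: sum.cong)
  also have "\<dots> = (\<Sum>j<n. \<Sum>i<n. to_ac (v $ j) * (to_ac (A $$ (i, j)) * x ^ i))"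
    unfolding sum_distrib_right by (subst sum.swap) (simp add: mult_ac)
  also have "\<dots> = (\<Sum>j<n. to_ac (v $ j) * vec_to_K (A *\<^sub>v unit_vec n j))"
    unfolding vec_to_K_def sum_distrib_left using A
    by (intro sum.cong) auto
  finally show ?thesis .
qed

lemma vec_to_K_companion:
  assumes v: "v \<in> carrier_vec n"
  shows "vec_to_K (companion_mat f *\<^sub>v v) = x * vec_to_K v"
proof -
  have C: "companion_mat f \<in> carrier_mat n n" by (simp add: companion_mat_def degree_f)
  have col: "vec_to_K (companion_mat f *\<^sub>v unit_vec n j) = x * x ^ j" if j: "j < n" for j
  proof (cases "j + 1 < n")
    case True
    then show ?thesis using companion_mat_mult_unit_vec[of j f] degree_f vec_to_K_unit[of "j + 1"] by simp
  next
    case False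
    then have jn: "j = n - 1" using j by auto
    have "0 = (\<Sum>i\<le>n. to_ac (Polynomial.coeff f i) * x ^ i)"
      using root_f by (simp add: poly_altdef degree_map_f coeff_map_poly)
    also have "\<dots> = (\<Sum>i<n. to_ac (Polynomial.coeff f i) * x ^ i) + x ^ n"
      using monic_f by (simp flip: lessThan_Suc_atMost)
    finally have "x ^ n = - (\<Sum>i<n. to_ac (Polynomial.coeff f i) * x ^ i)"
      by (simp add: eq_neg_iff_add_eq_0 add.commute)
    also have "\<dots> = vec_to_K (vec n (\<lambda>i. - Polynomial.coeff f i))"
      by (simp add: vec_to_K_def sum_negf)
    also have "vec n (\<lambda>i. - Polynomial.coeff f i) = companion_mat f *\<^sub>v unit_vec n j"
      using companion_mat_mult_last_unit_vec[of f] n_pos unfolding jn degree_f by simp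
    finally show ?thesis using n_pos unfolding jn by (simp flip: power_Suc)
  qed
  have "vec_to_K (companion_mat f *\<^sub>v v) = (\<Sum>j<n. to_ac (v $ j) * (x * x ^ j))"
    unfolding vec_to_K_mult_mat_vec[OF C v] by (intro sum.cong) (auto simp: col)
  then show ?thesis by (simp add: vec_to_K_def sum_distrib_left mult_ac)
qed

lemma frobenius_sum: "sum (\<lambda>i. g i) A ^ (CARD('p) ^ k) = sum (\<lambda>i. g i ^ (CARD('p) ^ k)) A"
  for g :: "'b \<Rightarrow> 'p mod_ring alg_closure"
  by (rule freshmans_dream_sum') (simp_all add: prime_card)

lemma to_ac_frobenius: "to_ac (c :: 'p mod_ring) ^ (CARD('p) ^ k) = to_ac c"
  by (metis CARD_mod_ring finite_field_power_card_power_eq_same to_ac_power)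

text \<open>
  Raising to a power of \<open>p\<close> is additive and fixes the coefficients of \<open>f\<close>.
\<close>

lemma conjugate_root: "poly (map_poly to_ac f) (x ^ (CARD('p) ^ k)) = 0"
proof -
  have "poly (map_poly to_ac f) (x ^ (CARD('p) ^ k))
      = (\<Sum>i\<le>n. (to_ac (Polynomial.coeff f i) * x ^ i) ^ (CARD('p) ^ k))"
    by (simp add: poly_altdef degree_map_f coeff_map_poly power_mult_distrib to_ac_frobenius
        mult.commute flip: power_mult)
  also have "\<dots> = (\<Sum>i\<le>n. to_ac (Polynomial.coeff f i) * x ^ i) ^ (CARD('p) ^ k)"
    by (rule frobenius_sum[symmetric])
  also have "(\<Sum>i\<le>n. to_ac (Polynomial.coeff f i) * x ^ i) = 0"
    using root_f by (simp add: poly_altdef degree_map_f coeff_map_poly)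
  finally show ?thesis by simp
qed

lemma conjugates_inj: "inj_on (\<lambda>k. x ^ (CARD('p) ^ k)) {..<n}"
proof (rule linorder_inj_onI')
  fix i j assume ij: "i \<in> {..<n}" "j \<in> {..<n}" "i < j"
  let ?q = "CARD('p)"
  have q: "?q > 1" by (rule nontriv)
  have lt: "?q ^ i < ?q ^ j" using ij q by simp
  show "x ^ (?q ^ i) \<noteq> x ^ (?q ^ j)"
  proof
    assume "x ^ (?q ^ i) = x ^ (?q ^ j)"
    also have "\<dots> = x ^ (?q ^ i) * x ^ (?q ^ j - ?q ^ i)" using lt by (simp flip: power_add)
    finally have "x ^ (?q ^ j - ?q ^ i) = 1" using x_nz by simp
    then have "?q ^ n - 1 dvd ?q ^ j - ?q ^ i" using x_power_eq_1 by simp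
    then have "?q ^ n - 1 \<le> ?q ^ j - ?q ^ i" using lt by (intro dvd_imp_le) auto
    moreover have "?q ^ j < ?q ^ n" using ij q by simp
    moreover have "?q ^ i \<ge> 1" using q by simp
    ultimately show False using lt by linarith
  qed
qed

definition norm_exponent :: nat where
  "norm_exponent = (\<Sum>i<n. CARD('p) ^ i)"

lemma norm_exponent_mult: "(CARD('p) - 1) * norm_exponent = CARD('p) ^ n - 1"
proof -
  obtain r where r: "CARD('p) = Suc r" using nontriv[where 'a = 'p] by (cases "CARD('p)") auto
  have "r * (\<Sum>i<m. Suc r ^ i) + 1 = Suc r ^ m" for m
    by (induction m) (simp_all add: algebra_simps)
  from this[of n] show ?thesis by (simp add: norm_exponent_def r)
qed

lemma norm_exponent_pos: "norm_exponent > 0"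
  using norm_exponent_mult card_power_gt by (cases "norm_exponent = 0") auto

text \<open>
  The \<open>n\<close> conjugates of \<open>x\<close> are distinct roots of \<open>f\<close>, so \<open>f\<close> is the product of the corresponding linear factors; compare
  constant terms.
\<close>

lemma norm_x: "to_ac ((- 1) ^ n * Polynomial.coeff f 0) = x ^ norm_exponent"
proof -
  let ?c = "\<lambda>k. x ^ (CARD('p) ^ k)"
  define P where "P = (\<Prod>k<n. [:- ?c k, 1:])"
  have deg: "Polynomial.degree P = n" unfolding P_def
    by (subst degree_prod_eq_sum_degree) auto
  have lead: "Polynomial.coeff P n = 1"
    using lead_coeff_prod[of "\<lambda>k. [:- ?c k, 1:]" "{..<n}"] deg unfolding P_def by simp
  have "map_poly to_ac f = P"
  proof (rule poly_eqI_degree_lead_coeff[where n = n and A = "?c ` {..<n}"])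
    show "poly (map_poly to_ac f) z = poly P z" if "z \<in> ?c ` {..<n}" for z
      using that conjugate_root by (auto simp: P_def poly_prod intro!: prod_zero[symmetric])
    show "n \<le> card (?c ` {..<n})" by (simp add: card_image[OF conjugates_inj])
  qed (use deg lead degree_map_f monic_f in \<open>auto simp: coeff_map_poly\<close>)
  then have "to_ac (Polynomial.coeff f 0) = poly P 0"
    by (metis coeff_map_poly poly_0_coeff_0 to_ac_0)
  also have "\<dots> = (- 1) ^ n * (\<Prod>k<n. ?c k)"
    by (simp add: P_def poly_prod prod_uminus)
  also have "(\<Prod>k<n. ?c k) = x ^ norm_exponent"
    by (simp add: norm_exponent_def power_sum)
  finally show ?thesis by (simp flip: mult.assoc power_add)
qed

lemma norm_power_eq_1:
  assumes "((- 1) ^ n * Polynomial.coeff f 0) ^ k = 1"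
  shows "CARD('p) - 1 dvd k"
proof -
  have "x ^ (norm_exponent * k) = to_ac (((- 1) ^ n * Polynomial.coeff f 0) ^ k)"
    unfolding power_mult norm_x[symmetric] by simp
  then have "CARD('p) ^ n - 1 dvd norm_exponent * k" using assms x_power_eq_1 by simp
  then have "norm_exponent * (CARD('p) - 1) dvd norm_exponent * k"
    unfolding norm_exponent_mult[symmetric] by (simp add: mult.commute)
  then show ?thesis using norm_exponent_pos by simp
qed

text \<open>
  An element of the prime field is a power \<open>x ^ j\<close> that is killed by \<open>p - 1\<close>; as the order of \<open>x\<close> is
  \<open>(p - 1) * norm_exponent\<close>, the exponent \<open>j\<close> is a multiple of \<open>norm_exponent\<close>.
\<close>

lemma norm_generates:
  assumes d: "d \<noteq> 0"
  shows "\<exists>k. d = ((- 1) ^ n * Polynomial.coeff f 0) ^ k"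
proof -
  obtain j where j: "to_ac d = x ^ j" using power_of_x[OF to_ac_in, of d] d by auto
  have "d ^ (CARD('p) - 1) * d = 1 * d"
    using finite_field_power_card_eq_same[of d] nontriv[where 'a = 'p] by (simp flip: power_Suc2)
  then have "d ^ (CARD('p) - 1) = 1" using d by simp
  then have "x ^ (j * (CARD('p) - 1)) = 1" unfolding power_mult j[symmetric] by (simp flip: to_ac_power)
  then have "(CARD('p) - 1) * norm_exponent dvd (CARD('p) - 1) * j"
    unfolding x_power_eq_1 norm_exponent_mult by (simp add: mult.commute)
  moreover have "CARD('p) - 1 > 0" using nontriv[where 'a = 'p] by simp
  ultimately have "norm_exponent dvd j" by (simp only: nat_mult_dvd_cancel1)
  then obtain k where "j = norm_exponent * k" by blast
  then have "to_ac d = (x ^ norm_exponent) ^ k" by (simp add: j power_mult)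
  also have "\<dots> = to_ac (((- 1) ^ n * Polynomial.coeff f 0) ^ k)"
    unfolding norm_x[symmetric] by (rule to_ac_power[symmetric])
  finally have "d = ((- 1) ^ n * Polynomial.coeff f 0) ^ k" by (simp only: to_ac_eq_iff)
  then show ?thesis by blast
qed

end

section \<open>Matrix groups containing a Singer cycle and a homology\<close>

text \<open>
  The homology may be taken with axis the vanishing of the last coordinate, because powers of the matrix \<open>S\<close> have this axis.
  The nonzero last entry of \<open>u\<close> makes it a homology and not a transvection.
\<close>

locale singer_group = primitive_field f K x n
  for f :: "'p :: prime_card mod_ring poly" and K x n +
  fixes H :: "'p mod_ring mat set" and u :: "'p mod_ring vec"
  assumes n_ge: "n \<ge> 3" and card_gt_2: "CARD('p) > 2"
    and H_carrier: "A \<in> H \<Longrightarrow> A \<in> carrier_mat n n"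
    and H_mult: "A \<in> H \<Longrightarrow> B \<in> H \<Longrightarrow> A * B \<in> H"
    and H_inverse: "A \<in> H \<Longrightarrow> \<exists>B \<in> H. A * B = 1\<^sub>m n \<and> B * A = 1\<^sub>m n"
    and companion_in: "companion_mat f \<in> H"
    and u_carrier: "u \<in> carrier_vec n" and u_last: "u $ (n - 1) \<noteq> 0"
    and homology_in: "rank_one_update n u (unit_vec n (n - 1)) \<in> H"
begin

lemma one_mat_in: "1\<^sub>m n \<in> H"
  using H_inverse[OF companion_in] H_mult companion_in by metis

definition coord :: "'p mod_ring alg_closure \<Rightarrow> 'p mod_ring vec" where
  "coord = inv_into (carrier_vec n) vec_to_K"

lemma coord_vec_to_K: "v \<in> carrier_vec n \<Longrightarrow> coord (vec_to_K v) = v"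
  unfolding coord_def using vec_to_K_bij by (auto simp: bij_betw_def)

lemma coord_carrier: "y \<in> K \<Longrightarrow> coord y \<in> carrier_vec n"
  by (metis K_cases coord_vec_to_K)

lemma vec_to_K_coord: "y \<in> K \<Longrightarrow> vec_to_K (coord y) = y"
  by (metis K_cases coord_vec_to_K)

lemma coord_add: "y \<in> K \<Longrightarrow> z \<in> K \<Longrightarrow> coord (y + z) = coord y + coord z"
  by (rule vec_to_K_eqD) (simp_all add: coord_carrier vec_to_K_coord vec_to_K_add add_in)

lemma coord_scale: "y \<in> K \<Longrightarrow> coord (to_ac c * y) = c \<cdot>\<^sub>v coord y"
  by (rule vec_to_K_eqD) (simp_all add: coord_carrier vec_to_K_coord vec_to_K_smult mult_in to_ac_in)

text \<open>
  The last coordinate, rescaled so that the homology with direction \<open>u\<close> becomes, after conjugation by a scaling, the map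
  \<open>y \<mapsto> y + ell y\<close> with direction \<open>1\<close>.
\<close>

definition ell :: "'p mod_ring alg_closure \<Rightarrow> 'p mod_ring" where
  "ell y = coord (vec_to_K u * y) $ (n - 1)"

lemma ell_add:
  assumes "y \<in> K" "z \<in> K"
  shows "ell (y + z) = ell y + ell z"
proof -
  have "dim_vec (coord (vec_to_K u * z)) = n"
    using coord_carrier[OF mult_in[OF vec_to_K_in assms(2)]] by (rule carrier_vecD)
  then show ?thesis
    using assms n_pos unfolding ell_def by (simp add: distrib_left coord_add mult_in vec_to_K_in)
qed

lemma ell_scale:
  assumes "y \<in> K"
  shows "ell (to_ac c * y) = c * ell y"
proof -
  have "dim_vec (coord (vec_to_K u * y)) = n"
    using coord_carrier[OF mult_in[OF vec_to_K_in assms]] by (rule carrier_vecD)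
  moreover have "vec_to_K u * (to_ac c * y) = to_ac c * (vec_to_K u * y)" by (simp add: mult_ac)
  then have "ell (to_ac c * y) = (c \<cdot>\<^sub>v coord (vec_to_K u * y)) $ (n - 1)"
    unfolding ell_def using assms by (simp only: coord_scale mult_in vec_to_K_in)
  ultimately show ?thesis using n_pos by (simp add: ell_def)
qed

lemma ell_zero: "ell 0 = 0"
  using ell_scale[OF zero_in, of 0] by simp

lemma ell_diff: "y \<in> K \<Longrightarrow> z \<in> K \<Longrightarrow> ell (y - z) = ell y - ell z"
  using ell_add[of "y - z" z] diff_in by simp

lemma ell_to_ac: "ell (to_ac c) = c * ell 1"
  using ell_scale[OF one_in, of c] by simp

lemma ell_sum: "(\<And>i. i \<in> A \<Longrightarrow> g i \<in> K) \<Longrightarrow> ell (sum g A) = (\<Sum>i\<in>A. ell (g i))"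
  by (induction A rule: infinite_finite_induct) (auto simp: ell_zero ell_add sum_in)

lemma ell_one: "ell 1 \<noteq> 0"
  using u_last u_carrier by (simp add: ell_def coord_vec_to_K)

text \<open>
  Working with maps on \<open>K\<close> that some member of \<open>H\<close> induces turns matrix computations into field computations. Only the
  values on \<open>K\<close> matter.
\<close>

definition realised :: "('p mod_ring alg_closure \<Rightarrow> 'p mod_ring alg_closure) \<Rightarrow> bool" where
  "realised g \<longleftrightarrow> (\<exists>h \<in> H. \<forall>v \<in> carrier_vec n. vec_to_K (h *\<^sub>v v) = g (vec_to_K v))"

lemma realised_matrix_in:
  assumes g: "realised g" and A: "A \<in> carrier_mat n n"
    and eq: "\<And>v. v \<in> carrier_vec n \<Longrightarrow> vec_to_K (A *\<^sub>v v) = g (vec_to_K v)"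
  shows "A \<in> H"
proof -
  obtain h where h: "h \<in> H" "\<And>v. v \<in> carrier_vec n \<Longrightarrow> vec_to_K (h *\<^sub>v v) = g (vec_to_K v)"
    using g unfolding realised_def by blast
  have "A = h"
  proof (rule mat_eq_on_vecsI[OF A H_carrier[OF h(1)]])
    fix v :: "'p mod_ring vec" assume v: "v \<in> carrier_vec n"
    show "A *\<^sub>v v = h *\<^sub>v v"
      by (rule vec_to_K_eqD) (use v A H_carrier[OF h(1)] eq h(2) in auto)
  qed
  then show ?thesis using h(1) by simp
qed

lemma realised_cong:
  "realised g \<Longrightarrow> (\<And>y. y \<in> K \<Longrightarrow> g y = g' y) \<Longrightarrow> realised g'"
  unfolding realised_def using vec_to_K_in by metis

lemma realised_comp:
  assumes "realised g" "realised g'"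
  shows "realised (\<lambda>y. g (g' y))"
proof -
  obtain h where h: "h \<in> H" "\<And>v. v \<in> carrier_vec n \<Longrightarrow> vec_to_K (h *\<^sub>v v) = g (vec_to_K v)"
    using assms(1) unfolding realised_def by blast
  obtain h' where h': "h' \<in> H" "\<And>v. v \<in> carrier_vec n \<Longrightarrow> vec_to_K (h' *\<^sub>v v) = g' (vec_to_K v)"
    using assms(2) unfolding realised_def by blast
  note c = H_carrier[OF h(1)] H_carrier[OF h'(1)]
  have "vec_to_K (h * h' *\<^sub>v v) = g (g' (vec_to_K v))" if v: "v \<in> carrier_vec n" for v
    using assoc_mult_mat_vec[OF c v] h(2)[OF mult_mat_vec_carrier[OF c(2) v]] h'(2)[OF v] by simp
  then show ?thesis unfolding realised_def using H_mult[OF h(1) h'(1)] by blast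
qed

lemma realised_inverse:
  assumes g: "realised g" and right: "\<And>y. y \<in> K \<Longrightarrow> g (g' y) = y" and into: "\<And>y. y \<in> K \<Longrightarrow> g' y \<in> K"
  shows "realised g'"
proof -
  obtain h where h: "h \<in> H" "\<And>v. v \<in> carrier_vec n \<Longrightarrow> vec_to_K (h *\<^sub>v v) = g (vec_to_K v)"
    using g unfolding realised_def by blast
  obtain B where B: "B \<in> H" "B * h = 1\<^sub>m n" using H_inverse[OF h(1)] by blast
  note c = H_carrier[OF h(1)] H_carrier[OF B(1)]
  have "vec_to_K (B *\<^sub>v v) = g' (vec_to_K v)" if v: "v \<in> carrier_vec n" for v
  proof -
    define w where "w = coord (g' (vec_to_K v))"
    have gK: "g' (vec_to_K v) \<in> K" using into vec_to_K_in by blast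
    have w: "w \<in> carrier_vec n" "vec_to_K w = g' (vec_to_K v)"
      using coord_carrier[OF gK] vec_to_K_coord[OF gK] by (auto simp: w_def)
    have "h *\<^sub>v w = v"
      by (rule vec_to_K_eqD) (use c w v h(2)[OF w(1)] right[OF vec_to_K_in] in auto)
    then have "B *\<^sub>v v = (B * h) *\<^sub>v w" using assoc_mult_mat_vec[OF c(2,1) w(1)] by simp
    then show ?thesis using w B(2) by simp
  qed
  then show ?thesis unfolding realised_def using B(1) by blast
qed

lemma realised_inj:
  assumes g: "realised g" and yz: "y \<in> K" "z \<in> K" and eq: "g y = g z"
  shows "y = z"
proof -
  obtain h where h: "h \<in> H" "\<And>v. v \<in> carrier_vec n \<Longrightarrow> vec_to_K (h *\<^sub>v v) = g (vec_to_K v)"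
    using g unfolding realised_def by blast
  obtain B where B: "B \<in> H" "B * h = 1\<^sub>m n" using H_inverse[OF h(1)] by blast
  note c = H_carrier[OF h(1)] H_carrier[OF B(1)]
  note cy = coord_carrier[OF yz(1)] and cz = coord_carrier[OF yz(2)]
  have "h *\<^sub>v coord y = h *\<^sub>v coord z"
    by (rule vec_to_K_eqD)
      (use c cy cz h(2)[OF cy] h(2)[OF cz] eq vec_to_K_coord yz in auto)
  then have "(B * h) *\<^sub>v coord y = (B * h) *\<^sub>v coord z"
    using assoc_mult_mat_vec[OF c(2,1) cy] assoc_mult_mat_vec[OF c(2,1) cz] by simp
  then have "coord y = coord z" using B(2) cy cz by simp
  then show ?thesis using vec_to_K_coord yz by metis
qed

text \<open>
  Every nonzero element of \<open>K\<close> is a power of \<open>x\<close>: this is where the companion matrix acts as a Singer cycle.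
\<close>

lemma realised_scaling:
  assumes "y \<in> K" "y \<noteq> 0"
  shows "realised (\<lambda>z. y * z)"
proof -
  have id: "realised (\<lambda>z. z)" unfolding realised_def using one_mat_in by (intro bexI[of _ "1\<^sub>m n"]) auto
  have C: "realised (\<lambda>z. x * z)" unfolding realised_def
    using companion_in by (intro bexI[of _ "companion_mat f"]) (auto simp: vec_to_K_companion)
  have "realised (\<lambda>z. x ^ i * z)" for i
  proof (induction i)
    case 0
    then show ?case using id by simp
  next
    case (Suc i)
    then show ?case using realised_comp[OF C Suc] by (simp add: mult.assoc)
  qed
  moreover obtain i where "y = x ^ i" using power_of_x assms by blast
  ultimately show ?thesis by simp
qed

text \<open>
  In terms of \<open>K\<close>, the rank-one perturbations of the identity: direction \<open>a\<close>, functional \<open>y \<mapsto> ell (c * y)\<close>. The map is a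
  transvection or trivial if \<open>ell (c * a) = 0\<close>, and a homology if it is invertible with \<open>ell (c * a) \<noteq> 0\<close>.
\<close>

definition rank_one_map :: "'p mod_ring alg_closure \<Rightarrow> 'p mod_ring alg_closure \<Rightarrow> 'p mod_ring alg_closure \<Rightarrow> 'p mod_ring alg_closure" where
  "rank_one_map a c y = y + to_ac (ell (c * y)) * a"

lemma rank_one_map_in: "a \<in> K \<Longrightarrow> y \<in> K \<Longrightarrow> rank_one_map a c y \<in> K"
  unfolding rank_one_map_def by (intro add_in mult_in to_ac_in)

lemma ell_mult_combination:
  assumes "c \<in> K" "y \<in> K" "w \<in> K"
  shows "ell (c * (y + to_ac k * w)) = ell (c * y) + k * ell (c * w)"
proof -
  have "c * (y + to_ac k * w) = c * y + to_ac k * (c * w)" by (simp add: algebra_simps)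
  then show ?thesis using assms by (simp add: ell_add ell_scale mult_in to_ac_in)
qed

lemma rank_one_map_combination:
  assumes "c \<in> K" "y \<in> K" "w \<in> K"
  shows "rank_one_map a c (y + to_ac k * w) = rank_one_map a c y + to_ac k * rank_one_map a c w"
  unfolding rank_one_map_def ell_mult_combination[OF assms] by (simp add: algebra_simps)

lemma realised_homology: "realised (rank_one_map (vec_to_K u) (inverse (vec_to_K u)))"
proof -
  have "vec_to_K u \<noteq> 0"
  proof
    assume "vec_to_K u = 0"
    then have "u = 0\<^sub>v n" by (rule vec_to_K_eq_0[OF u_carrier])
    then show False using u_last n_pos by simp
  qed
  then have ell: "ell (inverse (vec_to_K u) * vec_to_K v) = v $ (n - 1)" if "v \<in> carrier_vec n" for v
    using that by (simp add: ell_def coord_vec_to_K flip: mult.assoc)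
  have "vec_to_K (rank_one_update n u (unit_vec n (n - 1)) *\<^sub>v v) = rank_one_map (vec_to_K u) (inverse (vec_to_K u)) (vec_to_K v)"
    if v: "v \<in> carrier_vec n" for v
  proof -
    have "unit_vec n (n - 1) \<bullet> v = v $ (n - 1)" using v n_pos by simp
    then show ?thesis
      using rank_one_update_mult_vec[OF u_carrier unit_vec_carrier v, of "n - 1"] u_carrier v
      by (simp add: rank_one_map_def ell vec_to_K_add vec_to_K_smult)
  qed
  then show ?thesis unfolding realised_def using homology_in by blast
qed

lemma realised_rank_one_conj:
  assumes "realised (rank_one_map a c)" "a \<in> K" "c \<in> K" "y \<in> K" "y \<noteq> 0"
  shows "realised (rank_one_map (y * a) (c / y))"
proof -
  have inv: "inverse y \<in> K" "inverse y \<noteq> 0" using assms inverse_in by auto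
  from realised_comp[OF realised_scaling[OF assms(4,5)] realised_comp[OF assms(1) realised_scaling[OF inv]]]
  show ?thesis
    by (rule realised_cong) (use assms(5) in \<open>simp add: rank_one_map_def field_simps\<close>)
qed

text \<open>
  Conjugation by the scaling with factor \<open>y\<close> multiplies \<open>a\<close> and divides \<open>c\<close> by \<open>y\<close>, so only the product \<open>a * c\<close> matters.
\<close>

lemma realised_rank_one_normalise:
  assumes "a \<in> K" "a \<noteq> 0" "c \<in> K"
  shows "realised (rank_one_map a c) \<longleftrightarrow> realised (rank_one_map 1 (a * c))"
proof
  assume "realised (rank_one_map a c)"
  from realised_rank_one_conj[OF this assms(1,3) inverse_in[OF assms(1)]] assms
  show "realised (rank_one_map 1 (a * c))" by (simp add: field_simps)
next
  assume "realised (rank_one_map 1 (a * c))"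
  from realised_rank_one_conj[OF this one_in mult_in[OF assms(1,3)] assms(1,2)] assms
  show "realised (rank_one_map a c)" by simp
qed

text \<open>
  The map multiplies its direction \<open>a\<close> by this factor, and realised maps are injective.
\<close>

lemma realised_rank_one_multiplier:
  assumes "realised (rank_one_map a c)" "a \<in> K" "c \<in> K"
  shows "1 + ell (c * a) \<noteq> 0"
proof
  assume eq: "1 + ell (c * a) = 0"
  have "rank_one_map a c a = (1 + to_ac (ell (c * a))) * a" by (simp add: rank_one_map_def algebra_simps)
  also have "1 + to_ac (ell (c * a)) = to_ac (1 + ell (c * a))" by simp
  finally have "rank_one_map a c a = rank_one_map a c 0" unfolding eq by (simp add: rank_one_map_def ell_zero)
  from realised_inj[OF assms(1,2) zero_in this] eq show False by (simp add: ell_zero)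
qed

lemma realised_rank_one_inverse:
  assumes r: "realised (rank_one_map a c)" and ac: "a \<in> K" "c \<in> K"
  shows "realised (rank_one_map (to_ac (- 1 / (1 + ell (c * a))) * a) c)"
proof (rule realised_inverse[OF r])
  define m where "m = 1 + ell (c * a)"
  have m: "m \<noteq> 0" using realised_rank_one_multiplier[OF r ac] by (simp add: m_def)
  fix y assume y: "y \<in> K"
  define k where "k = - (ell (c * y) / m)"
  have "rank_one_map (to_ac (- 1 / m) * a) c y = y + to_ac k * a" by (simp add: rank_one_map_def k_def flip: mult.assoc)
  moreover have "rank_one_map a c (y + to_ac k * a) = y + to_ac (ell (c * y) + k * (1 + ell (c * a))) * a"
    unfolding rank_one_map_combination[OF ac(2) y ac(1)] by (simp add: rank_one_map_def algebra_simps)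
  moreover have "ell (c * y) + k * (1 + ell (c * a)) = 0" using m by (simp add: k_def flip: m_def)
  ultimately show "rank_one_map a c (rank_one_map (to_ac (- 1 / (1 + ell (c * a))) * a) c y) = y" by (simp add: m_def)
next
  fix y assume "y \<in> K"
  then show "rank_one_map (to_ac (- 1 / (1 + ell (c * a))) * a) c y \<in> K"
    by (intro rank_one_map_in mult_in to_ac_in ac)
qed

text \<open>
  Iterating a transvection multiplies its direction by a natural number, and every scalar of the prime field is one.
\<close>

lemma realised_rank_one_rescale:
  assumes r: "realised (rank_one_map (to_ac k) z)" and z: "z \<in> K" "ell z = 0" and k: "k \<noteq> 0"
  shows "realised (rank_one_map 1 z)"
proof -
  have "realised (rank_one_map (to_ac (of_nat m * k)) z)" for m
  proof (induction m)
    case 0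
    have "realised (rank_one_map 0 z)"
      by (rule realised_cong[OF realised_scaling[OF one_in]]) (simp_all add: rank_one_map_def)
    then show ?case by simp
  next
    case (Suc m)
    have "rank_one_map (to_ac k) z (rank_one_map (to_ac (of_nat m * k)) z y) = rank_one_map (to_ac (of_nat (Suc m) * k)) z y" if y: "y \<in> K" for y
    proof -
      have "rank_one_map (to_ac (of_nat m * k)) z y = y + to_ac (ell (z * y) * (of_nat m * k)) * 1"
        by (simp add: rank_one_map_def)
      then show ?thesis
        using rank_one_map_combination[OF z(1) y one_in, of "to_ac k" "ell (z * y) * (of_nat m * k)"] z(2)
        by (simp add: rank_one_map_def algebra_simps)
    qed
    then show ?case by (rule realised_cong[OF realised_comp[OF r Suc]])
  qed
  moreover obtain m where "inverse k = of_nat m" using surj_of_nat_mod_ring by blast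
  ultimately have "realised (rank_one_map (to_ac (inverse k * k)) z)" by metis
  then show ?thesis using k by simp
qed

text \<open>
  Let \<open>h\<close> have direction \<open>1\<close> and \<open>g\<close> have direction \<open>a\<close> and functional given by \<open>z\<close>. As \<open>ell z = 0\<close>, the map \<open>h\<close>
  preserves that functional, so \<open>h g h^(-1)\<close> differs from \<open>g\<close> only in its direction, which is
  \<open>h a = a + ell (r * a)\<close>. Dividing by \<open>g\<close> leaves a transvection whose direction is a nonzero multiple of \<open>1\<close>. The
  maps \<open>h\<close> and \<open>g\<close> may be homologies or transvections.
\<close>

lemma realised_rank_one_commutator:
  assumes rh: "realised (rank_one_map 1 r)" and rg: "realised (rank_one_map a z)"
    and K: "r \<in> K" "a \<in> K" "z \<in> K" and z: "ell z = 0" and ra: "ell (r * a) \<noteq> 0"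
  shows "realised (rank_one_map 1 z)"
proof -
  define m where "m = 1 + ell (z * a)"
  define l where "l = 1 + ell (r * 1)"
  have m: "m \<noteq> 0" using realised_rank_one_multiplier[OF rg K(2,3)] by (simp add: m_def)
  have l: "l \<noteq> 0" using realised_rank_one_multiplier[OF rh one_in K(1)] by (simp add: l_def)
  let ?ih = "rank_one_map (to_ac (- 1 / l) * 1) r" and ?ig = "rank_one_map (to_ac (- 1 / m) * a) z"
  have ih: "realised ?ih" unfolding l_def by (rule realised_rank_one_inverse[OF rh one_in K(1)])
  have ig: "realised ?ig" unfolding m_def by (rule realised_rank_one_inverse[OF rg K(2,3)])
  from realised_comp[OF rh realised_comp[OF rg realised_comp[OF ih ig]]]
  have "realised (rank_one_map (to_ac (ell (r * a) / m)) z)"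
  proof (rule realised_cong)
    fix y assume y: "y \<in> K"
    define y1 where "y1 = y + to_ac (- ell (z * y) / m) * a"
    have y1: "y1 \<in> K" unfolding y1_def by (intro add_in mult_in to_ac_in y K)
    have ig_y: "?ig y = y1" by (simp add: rank_one_map_def y1_def flip: mult.assoc)
    have zy1: "ell (z * y1) = ell (z * y) / m"
      unfolding y1_def ell_mult_combination[OF K(3) y K(2)] using m by (simp add: m_def field_simps)
    have zih: "ell (z * ?ih y1) = ell (z * y1)"
      using ell_mult_combination[OF K(3) y1 one_in, of "ell (r * y1) * (- 1 / l)"] z
      by (simp add: rank_one_map_def mult.commute)
    have hih: "rank_one_map 1 r (?ih y1) = y1"
    proof -
      define k where "k = - (ell (r * y1) / l)"
      have "?ih y1 = y1 + to_ac k * 1" by (simp add: rank_one_map_def k_def flip: mult.assoc)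
      moreover have "rank_one_map 1 r (y1 + to_ac k * 1) = y1 + to_ac (ell (r * y1) + k * l) * 1"
        unfolding rank_one_map_combination[OF K(1) y1 one_in] by (simp add: rank_one_map_def l_def algebra_simps)
      moreover have "ell (r * y1) + k * l = 0" using l by (simp add: k_def)
      ultimately show ?thesis by simp
    qed
    have ihK: "?ih y1 \<in> K" by (intro rank_one_map_in mult_in to_ac_in one_in y1)
    have "rank_one_map 1 r (rank_one_map a z (?ih y1)) = rank_one_map 1 r (?ih y1 + to_ac (ell (z * y) / m) * a)"
      unfolding rank_one_map_def[of a z "?ih y1"] zih zy1 ..
    also have "\<dots> = y1 + to_ac (ell (z * y) / m) * rank_one_map 1 r a"
      unfolding rank_one_map_combination[OF K(1) ihK K(2)] hih ..
    also have "\<dots> = y + to_ac (ell (z * y)) * to_ac (ell (r * a) / m)"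
      by (simp add: y1_def rank_one_map_def algebra_simps add_divide_distrib)
    also have "\<dots> = rank_one_map (to_ac (ell (r * a) / m)) z y"
      by (simp add: rank_one_map_def)
    finally show "rank_one_map 1 r (rank_one_map a z (?ih (?ig y))) = rank_one_map (to_ac (ell (r * a) / m)) z y"
      unfolding ig_y .
  qed
  then show ?thesis by (rule realised_rank_one_rescale) (use K z ra m in auto)
qed

lemma two_neq_zero: "(2 :: 'p mod_ring) \<noteq> 0"
proof
  assume "(2 :: 'p mod_ring) = 0"
  then have "CARD('p) dvd 2" using of_nat_0_mod_ring_dvd[of 2, where 'a = 'p] by simp
  then show False using card_gt_2 by (auto dest: dvd_imp_le)
qed

lemma kernel_decomposition:
  assumes y: "y \<in> K"
  shows "\<exists>c. y - to_ac c \<in> {y \<in> K. ell y = 0}"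
proof -
  define c where "c = ell y / ell 1"
  have "ell (y - to_ac c) = 0"
    using y ell_one by (simp add: ell_diff to_ac_in ell_to_ac) (simp add: c_def)
  then show ?thesis using y diff_in to_ac_in by blast
qed

lemma card_kernel_gt: "card (range (to_ac :: 'p mod_ring \<Rightarrow> _)) < card {y \<in> K. ell y = 0}"
proof -
  let ?F = "range (to_ac :: 'p mod_ring \<Rightarrow> _)" and ?U = "{y \<in> K. ell y = 0}"
  have card_F: "card ?F = CARD('p)" by (simp add: card_image inj_to_ac)
  have "K \<subseteq> (\<lambda>(c, y). c + y) ` (?F \<times> ?U)"
  proof
    fix y assume y: "y \<in> K"
    obtain c where "y - to_ac c \<in> ?U" using kernel_decomposition[OF y] by blast
    then show "y \<in> (\<lambda>(c, y). c + y) ` (?F \<times> ?U)"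
      by (intro image_eqI[where x = "(to_ac c, y - to_ac c)"]) auto
  qed
  moreover have fin: "finite (?F \<times> ?U)" using finite_K by simp
  ultimately have "card K \<le> card (?F \<times> ?U)" by (rule surj_card_le[rotated])
  also have "card K = CARD('p) * CARD('p) ^ (n - 1)" using n_pos by (simp add: card_K power_eq_if)
  also have "card (?F \<times> ?U) = CARD('p) * card ?U" by (simp add: card_cartesian_product card_F)
  finally have "CARD('p) ^ (n - 1) \<le> card ?U" by (rule mult_left_le_imp_le) simp
  moreover have "CARD('p) ^ 1 < CARD('p) ^ (n - 1)" using n_ge card_gt_2 by (intro power_strict_increasing) auto
  ultimately show ?thesis by (simp add: card_F)
qed

text \<open>
  With \<open>W\<close> the set of all \<open>z\<close> such that \<open>y \<mapsto> y + ell (z * y)\<close> is realised, the commutator of the maps with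
  parameters \<open>(1, r)\<close> and \<open>(s / z, z)\<close> gives the closure property that the field-theoretic lemma asks for.
\<close>

lemma kernel_subset_rank_one_maps: "{y \<in> K. ell y = 0} \<subseteq> {z \<in> K. realised (rank_one_map 1 z)}"
proof -
  interpret field_hyperplane K "range to_ac" "{y \<in> K. ell y = 0}"
  proof
    show "\<exists>c\<in>range to_ac. y - c \<in> {y \<in> K. ell y = 0}" if "y \<in> K" for y
      using kernel_decomposition[OF that] by blast
    show "inverse 2 \<in> range (to_ac :: 'p mod_ring \<Rightarrow> _)"
      by (metis rangeI to_ac_inverse to_ac_numeral)
    show "(2 :: 'p mod_ring alg_closure) \<noteq> 0"
      using two_neq_zero by (metis to_ac_eq_0_iff to_ac_numeral)
    show "y - z \<in> range to_ac" if "y \<in> range to_ac" "z \<in> range to_ac" for y z :: "'p mod_ring alg_closure"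
      using that by (auto simp flip: to_ac_diff)
    show "y * z \<in> range to_ac" if "y \<in> range to_ac" "z \<in> range to_ac" for y z :: "'p mod_ring alg_closure"
      using that by (auto simp flip: to_ac_mult)
  qed (use finite_K one_in diff_in mult_in inverse_in to_ac_in zero_in ell_zero ell_diff ell_scale ell_one card_kernel_gt in auto)
  show ?thesis
  proof (rule hyperplane_subset)
    let ?a = "vec_to_K u"
    have "?a \<noteq> 0" using u_last vec_to_K_eq_0[OF u_carrier] n_pos by auto
    then have "realised (rank_one_map 1 (?a * inverse ?a))"
      using realised_rank_one_normalise[OF vec_to_K_in _ inverse_in[OF vec_to_K_in]] realised_homology by blast
    then show "1 \<in> {z \<in> K. realised (rank_one_map 1 z)}" using \<open>?a \<noteq> 0\<close> one_in by simp
  next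
    fix y z
    assume y: "y \<in> {z \<in> K. realised (rank_one_map 1 z)} \<inter> {y \<in> K. ell y = 0}"
      and z: "z \<in> {z \<in> K. realised (rank_one_map 1 z)} \<inter> {y \<in> K. ell y = 0}"
    have "realised (rank_one_map (to_ac (- 1 / (1 + ell (z * 1))) * 1) z)"
      using z by (intro realised_rank_one_inverse one_in) auto
    then have sz: "realised (rank_one_map (- 1) z)" using z by simp
    have sy: "realised (rank_one_map 1 y)" using y by simp
    from realised_comp[OF sy sz] have "realised (rank_one_map 1 (y - z))"
    proof (rule realised_cong)
      fix t assume t: "t \<in> K"
      have "rank_one_map (- 1) z t = t + to_ac (- ell (z * t)) * 1" by (simp add: rank_one_map_def)
      then have "rank_one_map 1 y (rank_one_map (- 1) z t) = rank_one_map 1 y t + to_ac (- ell (z * t)) * rank_one_map 1 y 1"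
        using rank_one_map_combination[OF _ t one_in, of y 1 "- ell (z * t)"] y by simp
      also have "\<dots> = rank_one_map 1 (y - z) t"
        using y z t by (simp add: rank_one_map_def left_diff_distrib ell_diff mult_in)
      finally show "rank_one_map 1 y (rank_one_map (- 1) z t) = rank_one_map 1 (y - z) t" .
    qed
    then show "y - z \<in> {z \<in> K. realised (rank_one_map 1 z)}" using y z diff_in by auto
  next
    fix r s z
    assume r: "r \<in> {z \<in> K. realised (rank_one_map 1 z)}" and s: "s \<in> {z \<in> K. realised (rank_one_map 1 z)}"
      and z: "z \<in> {y \<in> K. ell y = 0}" "z \<noteq> 0" and out: "r * s / z \<in> K - {y \<in> K. ell y = 0}"
    have s0: "s \<noteq> 0" using out ell_zero zero_in by auto
    have a: "s / z \<in> K" "s / z \<noteq> 0" using s z s0 by (auto simp: divide_inverse intro: mult_in inverse_in)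
    have "realised (rank_one_map (s / z) z)"
      using realised_rank_one_normalise[OF a, of z] s z by simp
    then have "realised (rank_one_map 1 z)"
      using r z out a by (intro realised_rank_one_commutator[of r "s / z" z]) auto
    then show "z \<in> {z \<in> K. realised (rank_one_map 1 z)}" using z by simp
  qed
qed

definition functional :: "'p mod_ring alg_closure \<Rightarrow> 'p mod_ring vec" where
  "functional c = vec n (\<lambda>j. ell (c * x ^ j))"

lemma functional_carrier [simp]: "functional c \<in> carrier_vec n"
  by (simp add: functional_def)

lemma functional_scalar_prod:
  assumes c: "c \<in> K" and v: "v \<in> carrier_vec n"
  shows "functional c \<bullet> v = ell (c * vec_to_K v)"
proof -
  have "functional c \<bullet> v = (\<Sum>j<n. v $ j * ell (c * x ^ j))"
    using v by (simp add: functional_def scalar_prod_def atLeast0LessThan mult.commute)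
  also have "\<dots> = (\<Sum>j<n. ell (to_ac (v $ j) * (c * x ^ j)))"
    using c by (simp add: ell_scale mult_in power_in x_in)
  also have "\<dots> = ell (\<Sum>j<n. to_ac (v $ j) * (c * x ^ j))"
    by (rule ell_sum[symmetric]) (intro mult_in to_ac_in c power_in x_in)
  also have "(\<Sum>j<n. to_ac (v $ j) * (c * x ^ j)) = c * vec_to_K v"
    by (simp add: vec_to_K_def sum_distrib_left mult_ac)
  finally show ?thesis .
qed

text \<open>
  A functional vanishing on all of \<open>K\<close> cannot be \<open>y \<mapsto> ell (c * y)\<close> with nonzero \<open>c\<close>, since \<open>ell 1\<close> is nonzero. So
  \<open>c \<mapsto> functional c\<close> is injective between sets of the same size.
\<close>

lemma functional_surj:
  assumes m: "m \<in> carrier_vec n"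
  shows "\<exists>c \<in> K. functional c = m"
proof -
  have inj: "inj_on functional K"
  proof (rule inj_onI)
    fix c d assume cd: "c \<in> K" "d \<in> K" and eq: "functional c = functional d"
    have zero: "ell ((c - d) * y) = 0" if y: "y \<in> K" for y
    proof -
      have "ell (c * y) = ell (d * y)"
        using functional_scalar_prod[OF cd(1) coord_carrier[OF y]]
          functional_scalar_prod[OF cd(2) coord_carrier[OF y]] eq vec_to_K_coord[OF y] by simp
      then show ?thesis using cd y by (simp add: left_diff_distrib ell_diff mult_in)
    qed
    show "c = d"
    proof (rule ccontr)
      assume "c \<noteq> d"
      then have "(c - d) * inverse (c - d) = 1" by simp
      then show False using zero[OF inverse_in[OF diff_in[OF cd]]] ell_one by simp
    qed
  qed
  have "functional ` K = carrier_vec n"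
  proof (rule card_subset_eq)
    show "finite (carrier_vec n :: 'p mod_ring vec set)"
      using card_carrier_vec[of n, where 'a = "'p mod_ring"] by (intro card_ge_0_finite) simp
    show "card (functional ` K) = card (carrier_vec n :: 'p mod_ring vec set)"
      by (simp add: card_image[OF inj] card_K card_carrier_vec)
  qed auto
  then show ?thesis using m by (metis imageE)
qed

lemma transvection_in:
  assumes w: "w \<in> carrier_vec n" and m: "m \<in> carrier_vec n" and mw: "m \<bullet> w = 0"
  shows "rank_one_update n w m \<in> H"
proof -
  obtain c where c: "c \<in> K" "functional c = m" using functional_surj[OF m] by blast
  let ?a = "vec_to_K w"
  have "realised (rank_one_map ?a c)"
  proof (cases "?a = 0")
    case True
    then show ?thesis
      by (intro realised_cong[OF realised_scaling[OF one_in]]) (simp_all add: rank_one_map_def)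
  next
    case False
    have "ell (?a * c) = 0" using functional_scalar_prod[OF c(1) w] c(2) mw by (simp add: mult.commute)
    then have "realised (rank_one_map 1 (?a * c))"
      using kernel_subset_rank_one_maps mult_in[OF vec_to_K_in c(1)] by blast
    then show ?thesis using realised_rank_one_normalise[OF vec_to_K_in False c(1)] by simp
  qed
  then show ?thesis
  proof (rule realised_matrix_in)
    fix v :: "'p mod_ring vec" assume v: "v \<in> carrier_vec n"
    show "vec_to_K (rank_one_update n w m *\<^sub>v v) = rank_one_map ?a c (vec_to_K v)"
      using rank_one_update_mult_vec[OF w m v] functional_scalar_prod[OF c(1) v] c(2) w v
      by (simp add: vec_to_K_add vec_to_K_smult rank_one_map_def)
  qed simp
qed

text \<open>
  Reducing a member of \<open>H\<close> of determinant \<open>d\<close> by transvections shows that the dilation with determinant \<open>d\<close> lies in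
  \<open>H\<close>; powers of the companion matrix supply such a member for each \<open>d\<close>. Reducing an arbitrary invertible matrix to
  the same dilation then puts it into \<open>H\<close>.
\<close>

lemma invertible_in:
  assumes A: "A \<in> carrier_mat n n" and det_A: "det A \<noteq> 0"
  shows "A \<in> H"
proof -
  define P where "P = {A \<in> H. det A = 1}"
  define D where "D d = rank_one_update n ((d - 1) \<cdot>\<^sub>v unit_vec n (n - 1)) (unit_vec n (n - 1))" for d :: "'p mod_ring"
  interpret transvection_monoid n P
  proof
    show "A * B \<in> P" if "A \<in> P" "B \<in> P" for A B
      using that H_mult det_mult[of A n B] H_carrier unfolding P_def by auto
  qed (use n_ge H_carrier transvection_in det_transvection in \<open>auto simp: P_def\<close>)
  note C = H_carrier[OF companion_in]
  have det_C: "det (companion_mat f) = (- 1) ^ n * Polynomial.coeff f 0"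
    using det_companion_mat[of f] degree_f n_pos by simp
  have powers: "\<exists>B \<in> H. det B = det (companion_mat f) ^ k" for k
  proof (induction k)
    case 0
    then show ?case using one_mat_in by (intro bexI[of _ "1\<^sub>m n"]) auto
  next
    case (Suc k)
    then obtain B where "B \<in> H" "det B = det (companion_mat f) ^ k" by blast
    then show ?case using H_mult[OF companion_in, of B] det_mult[OF C H_carrier, of B]
      by (intro bexI[of _ "companion_mat f * B"]) auto
  qed
  obtain k where "det A = det (companion_mat f) ^ k" using norm_generates[OF det_A] det_C by auto
  then obtain B where B: "B \<in> H" "det B = det A" using powers[of k] by auto
  obtain h where h: "h \<in> P" "h * B = D (det A)"
    using reduce_to_dilation[OF H_carrier[OF B(1)]] B(2) det_A unfolding D_def by auto
  then have D_in: "D (det A) \<in> H" using H_mult[of h B] B(1) by (auto simp: P_def)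
  obtain g where g: "g \<in> P" "g * A = D (det A)"
    using reduce_to_dilation[OF A det_A] unfolding D_def by blast
  then obtain g' where g': "g' \<in> H" "g' * g = 1\<^sub>m n" using H_inverse by (auto simp: P_def)
  have "A = (g' * g) * A" using g' A by simp
  also have "\<dots> = g' * D (det A)"
    using assoc_mult_mat[OF H_carrier[OF g'(1)] P_carrier[OF g(1)] A] g(2) by simp
  finally show ?thesis using H_mult[OF g'(1) D_in] by simp
qed

end

section \<open>The general linear group\<close>

lemma GL_simps:
  "monoid.mult (GL n :: 'a :: field mat monoid) = (*)" "one (GL n :: 'a mat monoid) = 1\<^sub>m n"
  by (simp_all add: GL_def units_of_def ring_mat_simps)

lemma carrier_GL: "carrier (GL n :: 'a :: field mat monoid) = {A \<in> carrier_mat n n. det A \<noteq> 0}"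
proof -
  have "carrier (GL n :: 'a mat monoid) = Units (ring_mat TYPE('a) n ())"
    by (simp add: GL_def units_of_def)
  also have "\<dots> = {A \<in> carrier_mat n n. det A \<noteq> 0}"
    using unit_imp_det_non_zero[where 'a = 'a and n = n and b = "()"] det_non_zero_imp_unit[where 'a = 'a and n = n and b = "()"]
    by (auto simp: Units_def ring_mat_simps)
  finally show ?thesis .
qed

lemma group_GL: "group (GL n :: 'a :: field mat monoid)"
proof -
  interpret ring "ring_mat TYPE('a) n ()" by (rule ring_mat)
  show ?thesis unfolding GL_def by (rule units_group)
qed

theorem mainTheorem2:
  fixes p n :: nat
    and f :: "'p :: prime_card mod_ring poly"
    and C G :: "'p mod_ring mat"
    and Gs :: "nat \<Rightarrow> 'p mod_ring mat"
  assumes "p = CARD('p)" and "p \<ge> 5" and "n \<ge> 3"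
    and "Polynomial.degree f = n" and "primitive_poly f"
    and "C = companion_mat f"
    and "G = companion_mat (Polynomial.monom 1 n - 1)"
    and "Gs 1 = C"
    and "\<And>k. 1 \<le> k \<Longrightarrow> k \<le> n - 1 \<Longrightarrow>
           Gs (k + 1) = G \<otimes>\<^bsub>GL n\<^esub> Gs k \<otimes>\<^bsub>GL n\<^esub> inv\<^bsub>GL n\<^esub> G"
  shows "- Polynomial.coeff f 0 \<noteq> 1 \<and>
    (\<not> (p - 1) dvd n \<longrightarrow>
       (- Polynomial.coeff f 0) ^ n \<noteq> 1 \<and> generate (GL n) (Gs ` {1..n}) = carrier (GL n))"
proof -
  let ?a = "- Polynomial.coeff f 0"
  note p = assms(1) and p5 = assms(2) and n3 = assms(3) and deg = assms(4)
  obtain K x where "primitive_field f K x n"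
    using primitive_poly_imp_primitive_field[OF assms(5) deg] n3 by auto
  then interpret primitive_field f K x n .
  have sign: "((- 1) ^ n * Polynomial.coeff f 0)\<^sup>2 = ?a\<^sup>2"
    by (cases "even n") simp_all
  \<comment> \<open>The two bases differ by the sign \<open>(-1)^(n+1)\<close>, and \<open>n * (n + 1)\<close> is even.\<close>
  have sign_n: "((- 1) ^ n * Polynomial.coeff f 0) ^ n = ?a ^ n"
    by (cases "even n") (simp_all add: power_mult_distrib flip: power_mult)
  \<comment> \<open>Otherwise \<open>b\<close> would be a sign, although its order \<open>p - 1\<close> is at least four.\<close>
  have a_ne: "?a \<noteq> 1"
  proof
    assume "?a = 1"
    then have "CARD('p) - 1 dvd 2" using norm_power_eq_1[of 2] sign by simp
    then have "CARD('p) - 1 \<le> 2" by (rule dvd_imp_le) simp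
    then show False using p p5 by simp
  qed
  moreover {
    assume "\<not> (p - 1) dvd n"
    then have a_n: "?a ^ n \<noteq> 1" using norm_power_eq_1[of n] sign_n p by auto
    have n2: "n \<ge> 2" using n3 by simp
    interpret GL: group "GL n :: 'p mod_ring mat monoid" by (rule group_GL)
    note simps = GL_simps[where 'a = "'p mod_ring" and n = n]
    define H where "H = generate (GL n) (Gs ` {1..n})"
    have a0: "Polynomial.coeff f 0 \<noteq> 0"
      using norm_power_eq_1[of 0] norm_x x_nz n_pos
      by (metis mult_zero_right power_not_zero to_ac_0)
    have C_in: "C \<in> carrier (GL n)"
      using det_companion_mat[of f] deg n3 a0 assms(6) by (simp add: carrier_GL companion_mat_def)
    have Gc: "G \<in> carrier_mat n n" unfolding assms(7) using n2 by (rule cyclic_shift_carrier)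
    have G_in: "G \<in> carrier (GL n)"
    proof -
      have "det (G ^\<^sub>m n) = 1" using cyclic_shift_power[OF n2 assms(7)] by simp
      moreover have "det (G ^\<^sub>m k) = det G ^ k" for k
        using Gc by (induction k) (simp_all add: det_mult[of _ n])
      ultimately have "det G ^ n = 1" by simp
      then show ?thesis using Gc n3 by (auto simp: carrier_GL power_0_left)
    qed
    have Gs_in: "Gs k \<in> carrier (GL n)" if "1 \<le> k" "k \<le> n" for k
      using that
    proof (induction k rule: dec_induct)
      case base
      then show ?case using C_in assms(8) by simp
    next
      case (step k)
      then show ?case using assms(9)[of k] G_in by simp
    qed
    have gens: "Gs ` {1..n} \<subseteq> carrier (GL n)" using Gs_in by auto
    have H_sub: "subgroup H (GL n)" unfolding H_def by (rule GL.generate_is_subgroup[OF gens])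
    have H_carrier: "B \<in> carrier_mat n n" if "B \<in> H" for B
      using subgroup.mem_carrier[OF H_sub that] by (simp add: carrier_GL)
    have H_mult: "B * B' \<in> H" if "B \<in> H" "B' \<in> H" for B B'
      using subgroup.m_closed[OF H_sub that] by (simp add: simps)
    have H_one: "1\<^sub>m n \<in> H" using subgroup.one_closed[OF H_sub] by (simp add: simps)
    have H_inverse: "\<exists>B' \<in> H. B * B' = 1\<^sub>m n \<and> B' * B = 1\<^sub>m n" if B: "B \<in> H" for B
      using subgroup.m_inv_closed[OF H_sub B] GL.r_inv[OF subgroup.mem_carrier[OF H_sub B]]
        GL.l_inv[OF subgroup.mem_carrier[OF H_sub B]] by (auto simp: simps)
    have A_in: "Gs k \<in> H" if "1 \<le> k" "k \<le> n" for k
      unfolding H_def using that by (intro generate.incl) auto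
    define u where "u = (\<Sum>i<n. ?a ^ i) \<cdot>\<^sub>v last_column_change n f"
    have homology: "rank_one_update n u (unit_vec n (n - 1)) \<in> H"
      unfolding u_def
    proof (rule homology_power_in[OF n2 deg assms(7)])
      show "Gs (k + 1) * G = G * Gs k" if k: "1 \<le> k" "k \<le> n - 1" for k
      proof -
        have "Gs (k + 1) \<otimes>\<^bsub>GL n\<^esub> G = G \<otimes>\<^bsub>GL n\<^esub> Gs k"
          using assms(9)[OF k] G_in Gs_in[of k] k by (simp add: GL.m_assoc)
        then show ?thesis by (simp add: simps)
      qed
      show "Gs 1 = companion_mat f" using assms(6,8) by simp
    qed (use A_in H_carrier H_mult H_one in auto)
    interpret singer_group f K x n H u
    proof
      show "companion_mat f \<in> H" using A_in[of 1] assms(6,8) n3 by simp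
      show "u \<in> carrier_vec n" by (simp add: u_def last_column_change_def)
      have "u $ (n - 1) = (?a - 1) * (\<Sum>i<n. ?a ^ i)"
        using n3 by (simp add: u_def last_column_change_def mult.commute)
      also have "\<dots> = ?a ^ n - 1" by (rule power_diff_1_eq[symmetric])
      finally show "u $ (n - 1) \<noteq> 0" using a_n by simp
    qed (use n3 p p5 H_carrier H_mult H_inverse homology in auto)
    have "H = carrier (GL n)"
      using subgroup.subset[OF H_sub] invertible_in by (auto simp: carrier_GL)
    then have "?a ^ n \<noteq> 1 \<and> generate (GL n) (Gs ` {1..n}) = carrier (GL n)"
      using a_n by (simp add: H_def)
  }
  ultimately show ?thesis by blast
qed

end
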